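(* Let $A$ be a finite alphabet, let $M_A$ be the free inverse monoid on $A$, and let $\varphi$ be a monoid endomorphism of $M_A$. Then $\mathrm{Fix}(\varphi)=\{x\in M_A : x\varphi=x\}$ is a context-sensitive subset of $M_A$.
   Context: Let $A^{-1}$ be a set of formal inverses of $A$, $\widetilde{A}=A\cup A^{-1}$, and extend $a\mapsto a^{-1}$ to an involution on the free monoid $\widetilde{A}^*$ by $1^{-1}=1$, $(a^{-1})^{-1}=a$, $(uv)^{-1}=v^{-1}u^{-1}$. The free inverse monoid $M_A$ is the quotient of $\widetilde{A}^*$ by the congruence generated by $\{(uu^{-1}u,u)\mid u\in\widetilde{A}^*\}\cup\{(uu^{-1}vv^{-1},vv^{-1}uu^{-1})\mid u,v\in\widetilde{A}^*\}$, and $\pi:\widetilde{A}^*\to M_A$ is the canonical homomorphism. Maps are written on the right of their arguments. A subset $X\subseteq M_A$ is called context-sensitive if $X=L\pi$ for some context-sensitive language $L\subseteq\widetilde{A}^*$. Context-sensitive languages are those accepted by linear-bounded Turing machines. *)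

theory Defs
  imports "HOL-Algebra.Group"
begin

section \<open>Words over an alphabet with formal inverses\<close>

datatype 'a letter = Pos 'a | Neg 'a

text \<open>The alphabet of letters and formal inverses over \<open>A\<close>; words are lists, and the free
  monoid on \<open>X\<close> is \<open>lists X\<close> with append.\<close>

definition tilde :: "'a set \<Rightarrow> 'a letter set" where
  "tilde A = Pos ` A \<union> Neg ` A"

fun inv_letter :: "'a letter \<Rightarrow> 'a letter" where
  "inv_letter (Pos a) = Neg a"
| "inv_letter (Neg a) = Pos a"

definition inv_word :: "'a letter list \<Rightarrow> 'a letter list" where
  "inv_word u = rev (map inv_letter u)"

lemma inv_word_Nil [simp]: "inv_word [] = []"
  by (simp add: inv_word_def)

lemma inv_word_single [simp]: "inv_word [x] = [inv_letter x]"
  by (simp add: inv_word_def)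

lemma inv_word_append: "inv_word (u @ v) = inv_word v @ inv_word u"
  by (simp add: inv_word_def)

lemma inv_letter_inv [simp]: "inv_letter (inv_letter x) = x"
  by (cases x) simp_all

lemma inv_word_inv [simp]: "inv_word (inv_word u) = u"
  by (simp add: inv_word_def rev_map comp_def)

lemma inv_letter_in_tilde [simp]: "inv_letter x \<in> tilde A \<longleftrightarrow> x \<in> tilde A"
  by (cases x) (auto simp: tilde_def)

lemma set_inv_word [simp]: "set (inv_word u) = inv_letter ` set u"
  by (simp add: inv_word_def)

lemma inv_word_in_lists [simp]: "inv_word u \<in> lists (tilde A) \<longleftrightarrow> u \<in> lists (tilde A)"
  by (auto simp: inv_word_def lists_eq_set)


section \<open>The free inverse monoid\<close>

inductive_set generated_congruence :: "'s set \<Rightarrow> ('s list \<times> 's list) set \<Rightarrow> ('s list \<times> 's list) set"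
  for X :: "'s set" and R :: "('s list \<times> 's list) set" where
  base: "(u, v) \<in> R \<Longrightarrow> u \<in> lists X \<Longrightarrow> v \<in> lists X \<Longrightarrow> (u, v) \<in> generated_congruence X R"
| refl: "u \<in> lists X \<Longrightarrow> (u, u) \<in> generated_congruence X R"
| sym: "(u, v) \<in> generated_congruence X R \<Longrightarrow> (v, u) \<in> generated_congruence X R"
| trans: "(u, v) \<in> generated_congruence X R \<Longrightarrow> (v, w) \<in> generated_congruence X R \<Longrightarrow>
    (u, w) \<in> generated_congruence X R"
| append: "(u, v) \<in> generated_congruence X R \<Longrightarrow> (x, y) \<in> generated_congruence X R \<Longrightarrow>
    (u @ x, v @ y) \<in> generated_congruence X R"

definition inverse_monoid_relations :: "'a set \<Rightarrow> ('a letter list \<times> 'a letter list) set" where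
  "inverse_monoid_relations A =
     {(u @ inv_word u @ u, u) | u. u \<in> lists (tilde A)} \<union>
     {(u @ inv_word u @ v @ inv_word v, v @ inv_word v @ u @ inv_word u) | u v.
        u \<in> lists (tilde A) \<and> v \<in> lists (tilde A)}"

definition inverse_monoid_congruence :: "'a set \<Rightarrow> ('a letter list \<times> 'a letter list) set" where
  "inverse_monoid_congruence A = generated_congruence (tilde A) (inverse_monoid_relations A)"

definition proj :: "'a set \<Rightarrow> 'a letter list \<Rightarrow> 'a letter list set" where
  "proj A u = inverse_monoid_congruence A `` {u}"

definition free_inverse_monoid :: "'a set \<Rightarrow> 'a letter list set monoid" where
  "free_inverse_monoid A =
     \<lparr>carrier = lists (tilde A) // inverse_monoid_congruence A,
      mult = (\<lambda>P Q. \<Union>u\<in>P. \<Union>v\<in>Q. proj A (u @ v)),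
      one = proj A []\<rparr>"

lemma generated_congruence_in_lists:
  "(u, v) \<in> generated_congruence X R \<Longrightarrow> u \<in> lists X \<and> v \<in> lists X"
  by (induction rule: generated_congruence.induct) auto

lemma equiv_inverse_monoid_congruence:
  "equiv (lists (tilde A)) (inverse_monoid_congruence A)"
  unfolding inverse_monoid_congruence_def
proof (rule equivI)
  let ?C = "generated_congruence (tilde A) (inverse_monoid_relations A)"
  show "?C \<subseteq> lists (tilde A) \<times> lists (tilde A)"
    by (auto dest!: generated_congruence_in_lists)
  show "refl_on (lists (tilde A)) ?C"
    by (auto simp: refl_on_def intro: generated_congruence.refl dest: generated_congruence_in_lists)
  show "sym ?C"
    by (auto simp: sym_def intro: generated_congruence.sym)
  show "trans ?C"
    by (auto simp: trans_def intro: generated_congruence.trans)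
qed

lemma proj_eq_iff:
  assumes "u \<in> lists (tilde A)" "v \<in> lists (tilde A)"
  shows "proj A u = proj A v \<longleftrightarrow> (u, v) \<in> inverse_monoid_congruence A"
  unfolding proj_def using eq_equiv_class_iff[OF equiv_inverse_monoid_congruence assms] .

lemma carrier_free_inverse_monoid:
  "carrier (free_inverse_monoid A) = proj A ` lists (tilde A)"
  by (auto simp: free_inverse_monoid_def quotient_def proj_def)

lemma one_free_inverse_monoid: "\<one>\<^bsub>free_inverse_monoid A\<^esub> = proj A []"
  by (simp add: free_inverse_monoid_def)

lemma mult_free_inverse_monoid:
  assumes u: "u \<in> lists (tilde A)" and v: "v \<in> lists (tilde A)"
  shows "proj A u \<otimes>\<^bsub>free_inverse_monoid A\<^esub> proj A v = proj A (u @ v)"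
proof -
  let ?C = "inverse_monoid_congruence A"
  have eq: "proj A (x @ y) = proj A (u @ v)" if "(u, x) \<in> ?C" "(v, y) \<in> ?C" for x y
  proof -
    have "(u @ v, x @ y) \<in> ?C"
      using that unfolding inverse_monoid_congruence_def
      by (rule generated_congruence.append)
    then show ?thesis
      unfolding proj_def using equiv_class_eq[OF equiv_inverse_monoid_congruence] by metis
  qed
  have "u \<in> proj A u" "v \<in> proj A v"
    using u v equiv_class_self[OF equiv_inverse_monoid_congruence] by (auto simp: proj_def)
  moreover have "proj A (x @ y) = proj A (u @ v)" if "x \<in> proj A u" "y \<in> proj A v" for x y
    using that eq by (auto simp: proj_def)
  ultimately have "(\<Union>x\<in>proj A u. \<Union>y\<in>proj A v. proj A (x @ y)) = proj A (u @ v)"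
    by blast
  then show ?thesis by (simp add: free_inverse_monoid_def)
qed

lemma monoid_free_inverse_monoid: "monoid (free_inverse_monoid A)"
proof (rule monoidI)
  let ?M = "free_inverse_monoid A"
  note [simp del] = in_lists_conv_set
  note defs = carrier_free_inverse_monoid one_free_inverse_monoid
  show "\<one>\<^bsub>?M\<^esub> \<in> carrier ?M"
    by (simp add: defs)
  fix x y z assume "x \<in> carrier ?M"
  then obtain u where u: "u \<in> lists (tilde A)" "x = proj A u"
    by (auto simp: defs)
  show "\<one>\<^bsub>?M\<^esub> \<otimes>\<^bsub>?M\<^esub> x = x" "x \<otimes>\<^bsub>?M\<^esub> \<one>\<^bsub>?M\<^esub> = x"
    using u by (simp_all add: defs mult_free_inverse_monoid)
  assume "y \<in> carrier ?M"
  then obtain v where v: "v \<in> lists (tilde A)" "y = proj A v"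
    by (auto simp: defs)
  show "x \<otimes>\<^bsub>?M\<^esub> y \<in> carrier ?M"
    using u v by (simp add: defs mult_free_inverse_monoid)
  assume "z \<in> carrier ?M"
  then obtain w where w: "w \<in> lists (tilde A)" "z = proj A w"
    by (auto simp: defs)
  show "x \<otimes>\<^bsub>?M\<^esub> y \<otimes>\<^bsub>?M\<^esub> z = x \<otimes>\<^bsub>?M\<^esub> (y \<otimes>\<^bsub>?M\<^esub> z)"
    using u v w by (simp add: mult_free_inverse_monoid)
qed

lemma proj_inverse:
  assumes "u \<in> lists (tilde A)"
  shows "proj A (u @ inv_word u @ u) = proj A u"
  using assms
  by (subst proj_eq_iff)
    (auto simp: inverse_monoid_congruence_def inverse_monoid_relations_def
      intro!: generated_congruence.base)

lemma proj_idempotents_commute: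
  assumes "u \<in> lists (tilde A)" "v \<in> lists (tilde A)"
  shows "proj A (u @ inv_word u @ v @ inv_word v) = proj A (v @ inv_word v @ u @ inv_word u)"
  using assms
  by (subst proj_eq_iff)
    (auto simp: inverse_monoid_congruence_def inverse_monoid_relations_def
      intro!: generated_congruence.base)


section \<open>Linear-bounded Turing machines and context-sensitive languages\<close>

text \<open>Machines are nondeterministic. States and auxiliary tape symbols are natural numbers; only
  finitely many of each occur in a machine, so this loses no generality.\<close>

datatype 's tape_symbol = LeftEnd | RightEnd | Blank | Input 's | Work nat

datatype direction = GoLeft | Stay | GoRight

record 's turing_machine =
  states :: "nat set"
  tape_alphabet :: "'s tape_symbol set"
  transitions :: "(nat \<times> 's tape_symbol \<times> nat \<times> 's tape_symbol \<times> direction) set"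
  initial :: nat
  accepting :: "nat set"

text \<open>A machine over input alphabet \<open>X\<close> which never overwrites or moves past an end marker, and
  never writes one elsewhere: its head stays on the tape segment between the markers.\<close>

definition bounded_machine :: "'s set \<Rightarrow> 's turing_machine \<Rightarrow> bool" where
  "bounded_machine X M \<longleftrightarrow>
     finite (states M) \<and> finite (tape_alphabet M) \<and>
     {LeftEnd, RightEnd, Blank} \<union> Input ` X \<subseteq> tape_alphabet M \<and>
     initial M \<in> states M \<and> accepting M \<subseteq> states M \<and>
     (\<forall>(p, x, q, y, d) \<in> transitions M.
        p \<in> states M \<and> q \<in> states M \<and> x \<in> tape_alphabet M \<and> y \<in> tape_alphabet M \<and>
        (x = LeftEnd \<longleftrightarrow> y = LeftEnd) \<and> (x = RightEnd \<longleftrightarrow> y = RightEnd) \<and>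
        (x = LeftEnd \<longrightarrow> d \<noteq> GoLeft) \<and> (x = RightEnd \<longrightarrow> d \<noteq> GoRight))"

fun move :: "direction \<Rightarrow> nat \<Rightarrow> nat" where
  "move GoLeft i = i - 1"
| "move Stay i = i"
| "move GoRight i = i + 1"

text \<open>A configuration consists of the state, the tape contents and the head position.\<close>

type_synonym 's configuration = "nat \<times> 's tape_symbol list \<times> nat"

inductive step :: "'s turing_machine \<Rightarrow> 's configuration \<Rightarrow> 's configuration \<Rightarrow> bool"
  for M :: "'s turing_machine" where
  "(p, t ! i, q, y, d) \<in> transitions M \<Longrightarrow> i < length t \<Longrightarrow>
   step M (p, t, i) (q, t[i := y], move d i)"

text \<open>The linear bound: on an input \<open>w\<close> of length \<open>n\<close>, the machine works on \<open>n + k * n\<close> cells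
  between the end markers, for a constant \<open>k\<close> independent of \<open>w\<close>. For \<open>k = 0\<close> this is the
  linear-bounded automaton confined to the cells of its input.\<close>

definition initial_configuration ::
  "'s turing_machine \<Rightarrow> nat \<Rightarrow> 's list \<Rightarrow> 's configuration" where
  "initial_configuration M k w =
     (initial M,
      LeftEnd # map Input w @ replicate (k * length w) Blank @ [RightEnd],
      0)"

definition accepted_language :: "'s set \<Rightarrow> 's turing_machine \<Rightarrow> nat \<Rightarrow> 's list set" where
  "accepted_language X M k =
     {w \<in> lists X. \<exists>q t i. (step M)\<^sup>*\<^sup>* (initial_configuration M k w) (q, t, i) \<and> q \<in> accepting M}"

definition context_sensitive_language :: "'s set \<Rightarrow> 's list set \<Rightarrow> bool" where
  "context_sensitive_language X L \<longleftrightarrow>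
     (\<exists>M k. bounded_machine X M \<and> L = accepted_language X M k)"

definition context_sensitive_subset :: "'a set \<Rightarrow> 'a letter list set set \<Rightarrow> bool" where
  "context_sensitive_subset A S \<longleftrightarrow>
     (\<exists>L. context_sensitive_language (tilde A) L \<and> S = proj A ` L)"


section \<open>Endomorphisms and fixed points\<close>

text \<open>The library's \<open>hom\<close> only asks for compatibility with multiplication, so preservation of the
  identity is stated separately.\<close>

definition monoid_endomorphism :: "('b, 'c) monoid_scheme \<Rightarrow> ('b \<Rightarrow> 'b) \<Rightarrow> bool" where
  "monoid_endomorphism G \<phi> \<longleftrightarrow> \<phi> \<in> hom G G \<and> \<phi> \<one>\<^bsub>G\<^esub> = \<one>\<^bsub>G\<^esub>"

definition Fix :: "('b, 'c) monoid_scheme \<Rightarrow> ('b \<Rightarrow> 'b) \<Rightarrow> 'b set" where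
  "Fix G \<phi> = {x \<in> carrier G. \<phi> x = x}"

end

theory Submission
  imports Defs "HOL-Library.Sublist"
begin

text \<open>
  The endomorphism \<open>\<phi>\<close> is induced by a homomorphism \<open>h\<close> of words: choose for each letter \<open>x\<close> a word
  \<open>h x\<close> representing the value of \<open>\<phi>\<close> at \<open>x\<close>. Hence the fixed points of \<open>\<phi>\<close> are the elements
  represented by the words \<open>u\<close> such that \<open>u\<close> and \<open>h u\<close> are equal in the free inverse monoid, and it
  suffices to accept this language in linear space. More generally the equaliser of two word
  homomorphisms is context-sensitive (\<open>context_sensitive_equaliser\<close>).

  Membership can be tested in linear space because of Munn's theorem (\<open>munn\<close>): two words are equal in
  the free inverse monoid iff they are equal in the free group and the same elements of the free group
  are represented by their prefixes. So for each prefix of \<open>u\<close> one guesses a prefix of \<open>h u\<close> equal to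
  it in the free group, and vice versa. Both words have length linear in that of the input, and free
  reduction only shrinks words, so that each guess can be verified in linear space; the space is then
  used again for the next prefix. The prefixes that remain to be matched are recorded by a bounded
  amount of data in each cell of the tape.

  The computation is organised in sweeps: at each pass over the tape, a finite transducer
  rewrites it letter by letter. That iterated sweeps amount to a linear-bounded machine is proved once
  (\<open>context_sensitive_sweep\<close>). The transducer used here holds in each cell two short words, which
  concatenate to two words over the letters and their inverses, and may replace cell contents by
  anything of the same value in the free group. The soundness of reduction is thereby built into the
  transition relation, and for completeness it is enough to see that some cancellation is always
  possible (\<open>reduce_step\<close>).
\<close>

section \<open>Free reduction\<close>

fun cons_red :: "'a letter \<Rightarrow> 'a letter list \<Rightarrow> 'a letter list" where
  "cons_red x [] = [x]"
| "cons_red x (y # w) = (if y = inv_letter x then w else x # y # w)"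

fun red :: "'a letter list \<Rightarrow> 'a letter list" where
  "red [] = []"
| "red (x # u) = cons_red x (red u)"

fun reduced :: "'a letter list \<Rightarrow> bool" where
  "reduced [] \<longleftrightarrow> True"
| "reduced [x] \<longleftrightarrow> True"
| "reduced (x # y # w) \<longleftrightarrow> y \<noteq> inv_letter x \<and> reduced (y # w)"

lemma reduced_tl: "reduced (x # w) \<Longrightarrow> reduced w"
  by (cases w) auto

lemma reduced_cons_red: "reduced w \<Longrightarrow> reduced (cons_red x w)"
  by (cases w) (auto dest: reduced_tl)

lemma reduced_red: "reduced (red u)"
  by (induction u) (auto intro: reduced_cons_red)

lemma red_reduced: "reduced u \<Longrightarrow> red u = u"
  by (induction u rule: reduced.induct) auto

lemma cons_red_cancel: "reduced w \<Longrightarrow> cons_red x (cons_red (inv_letter x) w) = w"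
  by (cases w; cases "tl w") auto

lemma red_cancel_Cons: "red (x # inv_letter x # u) = red u"
  by (simp add: cons_red_cancel reduced_red)

lemma red_append_red_right: "red (u @ red v) = red (u @ v)"
  by (induction u) (auto simp: red_reduced reduced_red)

lemma red_cons_red_append: "red (cons_red x w @ v) = red (x # w @ v)"
  by (cases w) (auto simp: cons_red_cancel reduced_red)

lemma red_append_red_left: "red (red u @ v) = red (u @ v)"
  by (induction u) (auto simp: red_cons_red_append)

lemma red_append_cong: "red u = red u' \<Longrightarrow> red v = red v' \<Longrightarrow> red (u @ v) = red (u' @ v')"
  by (metis red_append_red_left red_append_red_right)

text \<open>Cancellation anywhere in a word preserves the reduced form, so \<open>red u = red v\<close> is equality in
  the free group; the laws below are those of a group.\<close>

lemma red_cancel: "red (u @ x # inv_letter x # v) = red (u @ v)"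
  by (rule red_append_cong[OF HOL.refl red_cancel_Cons])

lemma red_inv_word: "red (u @ inv_word u) = []"
proof (induction u)
  case (Cons x u)
  have "red ((x # u) @ inv_word (x # u)) = red ([x] @ (u @ inv_word u) @ [inv_letter x])"
    by (simp add: inv_word_def)
  also have "\<dots> = red ([x] @ [] @ [inv_letter x])"
    by (intro red_append_cong) (simp_all add: Cons.IH)
  finally show ?case by simp
qed simp

lemma red_inv_word': "red (inv_word u @ u) = []"
  using red_inv_word[of "inv_word u"] by simp

lemma red_append_inv: "red (u @ v @ inv_word v) = red u"
  using red_append_cong[OF HOL.refl, of "v @ inv_word v" "[]" u] by (simp add: red_inv_word)

lemma red_left_cancel: "red (u @ v) = red (u @ w) \<longleftrightarrow> red v = red w"
proof
  assume "red (u @ v) = red (u @ w)"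
  then have "red (inv_word u @ u @ v) = red (inv_word u @ u @ w)"
    by (rule red_append_cong[OF HOL.refl])
  moreover have "red (inv_word u @ u @ z) = red z" for z
    using red_append_cong[of "inv_word u @ u" "[]" z z] by (simp add: red_inv_word')
  ultimately show "red v = red w" by simp
qed (rule red_append_cong[OF HOL.refl])

lemma red_right_cancel: "red (v @ u) = red (w @ u) \<longleftrightarrow> red v = red w"
proof
  assume "red (v @ u) = red (w @ u)"
  then have "red ((v @ u) @ inv_word u) = red ((w @ u) @ inv_word u)"
    by (rule red_append_cong) simp
  then show "red v = red w" by (simp add: red_append_inv)
qed (rule red_append_cong[OF _ HOL.refl])

lemma not_reducedE:
  assumes "\<not> reduced w"
  obtains u x v where "w = u @ x # inv_letter x # v"
proof -
  have "\<exists>u x v. w = u @ x # inv_letter x # v"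
    using assms
  proof (induction w rule: reduced.induct)
    case (3 x y w)
    show ?case
    proof (cases "y = inv_letter x")
      case True
      then show ?thesis by (intro exI[of _ "[]"]) auto
    next
      case False
      then obtain u z v where "y # w = u @ z # inv_letter z # v" using 3 by auto
      then show ?thesis by (intro exI[of _ "x # u"]) auto
    qed
  qed auto
  then show ?thesis using that by blast
qed

text \<open>\<open>red\<close> recurses from the left, whereas prefixes of a word grow on the right; this is the bridge.\<close>

lemma red_snoc:
  "red (u @ [x]) = red u @ [x] \<or>
   (\<exists>r. red u = r @ [inv_letter x] \<and> red (u @ [x]) = r)"
proof -
  have *: "red (r @ [x]) = r @ [x] \<or> (\<exists>r'. r = r' @ [inv_letter x] \<and> red (r @ [x]) = r')"
    if "reduced r" for r
    using that
  proof (induction r)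
    case (Cons y r)
    have "red (r @ [x]) = r @ [x] \<or> (\<exists>r'. r = r' @ [inv_letter x] \<and> red (r @ [x]) = r')"
      using Cons.IH reduced_tl[OF Cons.prems] by blast
    then show ?case
    proof (elim disjE exE conjE)
      assume "red (r @ [x]) = r @ [x]"
      with Cons.prems show ?case by (cases r) auto
    next
      fix r' assume "r = r' @ [inv_letter x]" "red (r @ [x]) = r'"
      with Cons.prems show ?case by (cases r') auto
    qed
  qed simp
  show ?thesis
    using *[OF reduced_red, of u] by (simp add: red_append_red_left)
qed

lemma set_cons_red: "set (cons_red x w) \<subseteq> insert x (set w)"
  by (cases w) auto

lemma red_in_lists: "u \<in> lists X \<Longrightarrow> red u \<in> lists X"
proof (induction u)
  case (Cons x u)
  then show ?case using set_cons_red[of x "red u"] by auto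
qed simp


section \<open>Munn trees and the word problem of the free inverse monoid\<close>

text \<open>The vertices that the path labelled \<open>u\<close> visits in the Cayley graph of the free group, each
  named by its reduced word. The edges can be recovered from the vertices, the Cayley graph being a
  tree.\<close>

definition munn_tree :: "'a letter list \<Rightarrow> 'a letter list set" where
  "munn_tree u = {red p | p. prefix p u}"

lemma munn_tree_append:
  "munn_tree (u @ v) = munn_tree u \<union> (\<lambda>r. red (red u @ r)) ` munn_tree v"
proof -
  have "(\<lambda>r. red (red u @ r)) ` munn_tree v = {red (u @ q) | q. prefix q v}"
    unfolding munn_tree_def
    by (simp add: setcompr_eq_image image_image red_append_red_left red_append_red_right)
  then show ?thesis by (auto simp: munn_tree_def prefix_append)
qed

lemma red_in_munn_tree: "red u \<in> munn_tree u"
  by (auto simp: munn_tree_def)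

text \<open>Reading \<open>inv_word u\<close> after \<open>u\<close> retraces the same path backwards.\<close>

lemma munn_tree_inv: "(\<lambda>r. red (red u @ r)) ` munn_tree (inv_word u) = munn_tree u"
proof -
  have tr: "red (red u @ red p) = red q" if "p @ inv_word q = inv_word u" for p q
  proof -
    have "u = q @ inv_word p"
      using arg_cong[OF that, of inv_word] by (simp add: inv_word_append)
    then have "red (u @ p) = red (q @ inv_word p @ inv_word (inv_word p))" by simp
    then show ?thesis
      by (simp only: red_append_inv red_append_red_left red_append_red_right)
  qed
  show ?thesis
  proof (intro equalityI subsetI)
    fix r assume "r \<in> (\<lambda>r. red (red u @ r)) ` munn_tree (inv_word u)"
    then obtain p z where pz: "p @ z = inv_word u" "r = red (red u @ red p)"
      by (auto simp: munn_tree_def prefix_def)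
    have "u = inv_word z @ inv_word p"
      using arg_cong[OF pz(1), of inv_word] by (simp add: inv_word_append)
    then have "prefix (inv_word z) u" by (auto simp: prefix_def)
    moreover have "r = red (inv_word z)" using tr[of p "inv_word z"] pz by simp
    ultimately show "r \<in> munn_tree u" by (auto simp: munn_tree_def)
  next
    fix r assume "r \<in> munn_tree u"
    then obtain q z where qz: "u = q @ z" "r = red q"
      by (auto simp: munn_tree_def prefix_def)
    then have "inv_word z @ inv_word q = inv_word u" by (simp add: inv_word_append)
    then have "prefix (inv_word z) (inv_word u)" "r = red (red u @ red (inv_word z))"
      using tr[of "inv_word z" q] qz by (auto intro: prefixI[OF HOL.sym])
    then show "r \<in> (\<lambda>r. red (red u @ r)) ` munn_tree (inv_word u)"
      by (auto simp: munn_tree_def)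
  qed
qed

lemma munn_tree_idem: "munn_tree (u @ inv_word u) = munn_tree u"
  by (simp add: munn_tree_append munn_tree_inv)

lemma munn_tree_idem_append:
  "munn_tree ((u @ inv_word u) @ v) = munn_tree u \<union> munn_tree v"
proof -
  have "(\<lambda>r. red (red (u @ inv_word u) @ r)) ` munn_tree v = munn_tree v"
    by (simp add: red_inv_word munn_tree_def red_reduced reduced_red setcompr_eq_image image_image)
  then show ?thesis
    unfolding munn_tree_append[of "u @ inv_word u"] munn_tree_idem by simp
qed

text \<open>The easy half of Munn's theorem: both sides of each defining relation trace out the same tree
  and end at the same vertex, and tree and end vertex of a product depend only on those of the
  factors.\<close>

lemma congruence_munn:
  assumes "(u, v) \<in> inverse_monoid_congruence A"
  shows "munn_tree u = munn_tree v \<and> red u = red v"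
  using assms unfolding inverse_monoid_congruence_def
proof (induction rule: generated_congruence.induct)
  case (base u v)
  have 1: "munn_tree (w @ inv_word w @ w) = munn_tree w \<and> red (w @ inv_word w @ w) = red w"
    for w :: "'a letter list"
    using munn_tree_idem_append[of w w] red_append_cong[of "w @ inv_word w" "[]" w w]
    by (simp add: red_inv_word)
  have 2: "munn_tree (x @ inv_word x @ y @ inv_word y) = munn_tree x \<union> munn_tree y \<and>
      red (x @ inv_word x @ y @ inv_word y) = []" for x y :: "'a letter list"
    using munn_tree_idem_append[of x "y @ inv_word y"] red_append_inv[of "x @ inv_word x" y]
    by (simp add: munn_tree_idem red_inv_word)
  from base show ?case
    unfolding inverse_monoid_relations_def by (auto simp: 1 2)
next
  case (append u v x y)
  then show ?case
    by (auto simp: munn_tree_append intro: red_append_cong)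
qed auto

context
  fixes A :: "'a set"
begin

private abbreviation (input) W where "W \<equiv> lists (tilde A)"

lemma proj_cong:
  assumes "proj A v = proj A v'" "u \<in> W" "v \<in> W" "v' \<in> W" "w \<in> W"
  shows "proj A (u @ v @ w) = proj A (u @ v' @ w)"
  using assms mult_free_inverse_monoid[of "v @ w" A] mult_free_inverse_monoid[of v A w] 
  by (metis append_in_lists_conv mult_free_inverse_monoid)

lemma proj_cong_left:
  assumes "proj A v = proj A v'" "v \<in> W" "v' \<in> W" "w \<in> W"
  shows "proj A (v @ w) = proj A (v' @ w)"
  using proj_cong[of v v' "[]" w] assms by simp

lemma proj_cong_right:
  assumes "proj A v = proj A v'" "u \<in> W" "v \<in> W" "v' \<in> W"
  shows "proj A (u @ v) = proj A (u @ v')"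
  using proj_cong[of v v' u "[]"] assms by simp

text \<open>These idempotents commute, and \<open>idem u\<close> is absorbed by a following \<open>u\<close>; the calculations
  below use little else.\<close>

definition idem :: "'a letter list \<Rightarrow> 'a letter list" where
  "idem u = u @ inv_word u"

lemma idem_in: "idem u \<in> W \<longleftrightarrow> u \<in> W"
  by (simp add: idem_def del: in_lists_conv_set)

lemma inv_idem: "inv_word (idem u) = idem u"
  by (simp add: idem_def inv_word_append)

lemma proj_idem_commute:
  assumes "u \<in> W" "x \<in> W" "y \<in> W" "v \<in> W"
  shows "proj A (u @ idem x @ idem y @ v) = proj A (u @ idem y @ idem x @ v)"
  using proj_cong[of "idem x @ idem y" "idem y @ idem x" u v] proj_idempotents_commute[of x A y] assms
  by (simp add: idem_def del: in_lists_conv_set)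

lemma proj_idem_absorb:
  assumes "u \<in> W" "x \<in> W" "v \<in> W"
  shows "proj A (u @ idem x @ x @ v) = proj A (u @ x @ v)"
  using proj_cong[of "idem x @ x" x u v] proj_inverse[of x A] assms
  by (simp add: idem_def del: in_lists_conv_set)

lemma proj_idem_absorb_right:
  assumes "u \<in> W" "x \<in> W" "v \<in> W"
  shows "proj A (u @ x @ idem (inv_word x) @ v) = proj A (u @ x @ v)"
  using proj_idem_absorb[OF assms] by (simp add: idem_def)

lemma proj_idem_idem:
  assumes "u \<in> W" "x \<in> W" "v \<in> W"
  shows "proj A (u @ idem x @ idem x @ v) = proj A (u @ idem x @ v)"
  using proj_idem_absorb[of u x "inv_word x @ v"] assms
  by (simp add: idem_def del: in_lists_conv_set)

text \<open>The natural partial order of the free inverse monoid, read on words. Its antisymmetry reduces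
  the hard half of Munn's theorem to inequalities.\<close>

definition below :: "'a letter list \<Rightarrow> 'a letter list \<Rightarrow> bool" where
  "below u v \<longleftrightarrow> u \<in> W \<and> v \<in> W \<and> proj A u = proj A (idem u @ v)"

lemma below_refl: "u \<in> W \<Longrightarrow> below u u"
  using proj_idem_absorb[of "[]" u "[]"] by (simp add: below_def del: in_lists_conv_set)

text \<open>The word \<open>idem u @ a @ b\<close> contains \<open>f = [x, inv_letter x]\<close> twice, with \<open>idem b\<close> in between.
  Commuting idempotents brings the two copies together, where they merge.\<close>

lemma below_cancel:
  assumes "a \<in> W" "x \<in> tilde A" "b \<in> W"
  shows "below (a @ [x, inv_letter x] @ b) (a @ b)"
proof -
  note [simp] = idem_in and [simp del] = in_lists_conv_set
  define f where "f = idem [x]"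
  have f: "f = [x, inv_letter x]" by (simp add: f_def idem_def)
  have [simp]: "x \<in> tilde A" by fact
  have xW [simp]: "[x] \<in> W" by simp
  then have fW [simp]: "f \<in> W" unfolding f_def idem_in .
  note W = assms(1,3)
  have "proj A (idem (a @ f @ b) @ a @ b) = proj A ((a @ f) @ idem b @ idem [x] @ (inv_word a @ a @ b))"
    by (simp add: idem_def inv_word_append[of a] inv_word_append[of "[x, inv_letter x]" b, simplified] f)
       (simp add: inv_word_def)
  also have "\<dots> = proj A ((a @ f) @ idem [x] @ idem b @ (inv_word a @ a @ b))"
    using W by (intro proj_idem_commute) simp_all
  also have "\<dots> = proj A ((a @ f @ f) @ idem b @ idem (inv_word a) @ b)"
    by (simp add: idem_def f)
  also have "\<dots> = proj A ((a @ f @ f) @ idem (inv_word a) @ idem b @ b)"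
    using W by (intro proj_idem_commute) simp_all
  also have "\<dots> = proj A ((a @ f @ f @ idem (inv_word a)) @ idem b @ b @ [])" by simp
  also have "\<dots> = proj A ((a @ f @ f @ idem (inv_word a)) @ b @ [])"
    using W by (intro proj_idem_absorb) simp_all
  also have "\<dots> = proj A (a @ idem [x] @ idem [x] @ (idem (inv_word a) @ b))"
    by (simp add: f_def)
  also have "\<dots> = proj A (a @ idem [x] @ (idem (inv_word a) @ b))"
    using W by (intro proj_idem_idem) simp_all
  also have "\<dots> = proj A (a @ idem (inv_word a) @ idem [x] @ b)"
    using W by (intro proj_idem_commute) simp_all
  also have "\<dots> = proj A ([] @ a @ idem (inv_word a) @ (idem [x] @ b))" by simp
  also have "\<dots> = proj A ([] @ a @ (idem [x] @ b))"
    using W by (intro proj_idem_absorb_right) simp_all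
  finally have "proj A (idem (a @ f @ b) @ a @ b) = proj A (a @ f @ b)" by (simp add: f_def)
  then show ?thesis
    using W by (simp add: below_def f)
qed

lemma inverse_relations_inv_word:
  assumes "(u, v) \<in> inverse_monoid_relations A"
  shows "(inv_word u, inv_word v) \<in> inverse_monoid_relations A"
proof -
  consider w where "w \<in> W" "u = w @ inv_word w @ w" "v = w"
    | x y where "x \<in> W" "y \<in> W" "u = x @ inv_word x @ y @ inv_word y"
        "v = y @ inv_word y @ x @ inv_word x"
    using assms unfolding inverse_monoid_relations_def by blast
  then show ?thesis
  proof cases
    case 1
    then have "inv_word u = inv_word w @ inv_word (inv_word w) @ inv_word w" "inv_word v = inv_word w"
      "inv_word w \<in> W"
      by (simp_all only: inv_word_append append_assoc inv_word_in_lists)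
    then show ?thesis unfolding inverse_monoid_relations_def by blast
  next
    case 2
    then have "inv_word u = y @ inv_word y @ x @ inv_word x"
      "inv_word v = x @ inv_word x @ y @ inv_word y"
      by (simp_all only: inv_word_append append_assoc inv_word_inv)
    with 2 show ?thesis unfolding inverse_monoid_relations_def by blast
  qed
qed

text \<open>Inversion swaps the two kinds of factors in the defining relations and so maps them to
  relations; hence it is well defined on the free inverse monoid.\<close>

lemma congruence_inv_word:
  assumes "(u, v) \<in> inverse_monoid_congruence A"
  shows "(inv_word u, inv_word v) \<in> inverse_monoid_congruence A"
  using assms unfolding inverse_monoid_congruence_def
proof (induction rule: generated_congruence.induct)
  case (base u v)
  then show ?case
    by (intro generated_congruence.base inverse_relations_inv_word)
      (simp_all only: inv_word_in_lists)
next
  case (refl u)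
  then show ?case
    by (intro generated_congruence.refl) (simp only: inv_word_in_lists)
next
  case (sym u v)
  show ?case by (rule generated_congruence.sym) (rule sym.IH)
next
  case (trans u v w)
  show ?case by (rule generated_congruence.trans) (rule trans.IH)+
next
  case (append u v x y)
  show ?case unfolding inv_word_append
    by (rule generated_congruence.append) (rule append.IH)+
qed

lemma proj_inv_word:
  assumes "proj A u = proj A v" "u \<in> W" "v \<in> W"
  shows "proj A (inv_word u) = proj A (inv_word v)"
  using assms congruence_inv_word[of u v]
  by (simp only: proj_eq_iff inv_word_in_lists)

lemma below_idem:
  assumes "below u v"
  shows "proj A (idem u @ idem v) = proj A (idem u)"
proof -
  have [simp]: "u \<in> W" "v \<in> W" using assms by (auto simp: below_def)
  note [simp] = idem_in and [simp del] = in_lists_conv_set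
  have eq: "proj A u = proj A (idem u @ v)"
    using assms by (simp add: below_def)
  have eq': "proj A (inv_word u) = proj A (inv_word v @ idem u)"
    using proj_inv_word[OF eq] by (simp add: inv_word_append inv_idem)
  have "proj A (idem u) = proj A ((idem u @ v) @ inv_word u)"
    by (subst idem_def, intro proj_cong_left eq) simp_all
  also have "\<dots> = proj A ((idem u @ v) @ (inv_word v @ idem u))"
    using eq' by (intro proj_cong_right) simp_all
  also have "\<dots> = proj A (idem u @ idem v @ idem u @ [])" by (simp add: idem_def)
  also have "\<dots> = proj A (idem u @ idem u @ idem v @ [])"
    by (intro proj_idem_commute) simp_all
  also have "\<dots> = proj A ([] @ idem u @ idem u @ idem v)" by simp
  also have "\<dots> = proj A ([] @ idem u @ idem v)"
    by (intro proj_idem_idem) simp_all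
  finally show ?thesis by simp
qed

lemma below_trans:
  assumes "below u v" "below v w"
  shows "below u w"
proof -
  have [simp]: "u \<in> W" "v \<in> W" "w \<in> W" using assms by (auto simp: below_def)
  note [simp] = idem_in and [simp del] = in_lists_conv_set
  have "proj A u = proj A (idem u @ v)"
    using assms by (simp add: below_def)
  also have "\<dots> = proj A (idem u @ (idem v @ w))"
    using assms by (intro proj_cong_right) (simp_all add: below_def)
  also have "\<dots> = proj A ((idem u @ idem v) @ w)" by simp
  also have "\<dots> = proj A (idem u @ w)"
    by (intro proj_cong_left below_idem assms) simp_all
  finally show ?thesis by (simp add: below_def)
qed

lemma below_antisym:
  assumes "below u v" "below v u"
  shows "proj A u = proj A v"
proof -
  have [simp]: "u \<in> W" "v \<in> W" using assms by (auto simp: below_def)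
  note [simp] = idem_in and [simp del] = in_lists_conv_set
  have "proj A u = proj A (idem u @ v)" using assms by (simp add: below_def)
  also have "\<dots> = proj A (idem u @ (idem v @ u))"
    using assms by (intro proj_cong_right) (simp_all add: below_def)
  also have "\<dots> = proj A ([] @ idem u @ idem v @ u)" by simp
  also have "\<dots> = proj A ([] @ idem v @ idem u @ u)"
    by (intro proj_idem_commute) simp_all
  also have "\<dots> = proj A (idem v @ idem u @ u @ [])" by simp
  also have "\<dots> = proj A (idem v @ u @ [])"
    by (intro proj_idem_absorb) simp_all
  also have "\<dots> = proj A v" using assms by (simp add: below_def)
  finally show ?thesis .
qed

lemma below_red: "u \<in> W \<Longrightarrow> below u (red u)"
proof (induction u rule: length_induct)
  case (1 u)
  show ?case
  proof (cases "reduced u")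
    case True
    then show ?thesis using 1 by (simp add: red_reduced below_refl)
  next
    case False
    then obtain a x b where u: "u = a @ x # inv_letter x # b" by (rule not_reducedE)
    with 1(2) have "below u (a @ b)" using below_cancel[of a x b] by simp
    moreover have "below (a @ b) (red u)"
      using 1 u by (auto simp: red_cancel)
    ultimately show ?thesis by (rule below_trans)
  qed
qed

lemma proj_idem_prefix:
  assumes "prefix q w" "w \<in> W"
  shows "proj A (idem w @ idem q) = proj A (idem w)"
proof -
  obtain z where w: "w = q @ z" using assms by (auto simp: prefix_def)
  note [simp] = idem_in and [simp del] = in_lists_conv_set
  have [simp]: "q \<in> W" "z \<in> W" using assms w by auto
  have "proj A (idem w @ idem q) = proj A ([] @ idem w @ idem q @ [])" by simp
  also have "\<dots> = proj A ([] @ idem q @ idem w @ [])"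
    using assms by (intro proj_idem_commute) simp_all
  also have "\<dots> = proj A ([] @ idem q @ q @ (z @ inv_word w))" by (simp add: w idem_def)
  also have "\<dots> = proj A ([] @ q @ (z @ inv_word w))"
    using assms by (intro proj_idem_absorb) simp_all
  finally show ?thesis by (simp add: idem_def w)
qed

text \<open>A vertex \<open>r\<close> of the tree is the reduced form of a prefix \<open>q\<close> of \<open>w\<close>, and
  \<open>idem w \<le> idem q \<le> idem r\<close>: deleting cancelling pairs only moves up in the natural order.\<close>

lemma proj_idem_munn_tree:
  assumes "r \<in> munn_tree w" "w \<in> W"
  shows "proj A (idem w @ idem r) = proj A (idem w)"
proof -
  obtain q where q: "prefix q w" "r = red q" using assms by (auto simp: munn_tree_def)
  note [simp] = idem_in and [simp del] = in_lists_conv_set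
  have [simp]: "q \<in> W" "w \<in> W" using q assms by (auto simp: prefix_def)
  then have [simp]: "r \<in> W" "red q \<in> W" by (simp_all add: q red_in_lists)
  have "proj A (idem w @ idem r) = proj A ((idem w @ idem q) @ idem r)"
    by (intro proj_cong_left proj_idem_prefix[symmetric] q) simp_all
  also have "\<dots> = proj A (idem w @ (idem q @ idem r))" by simp
  also have "\<dots> = proj A (idem w @ idem q)"
    by (intro proj_cong_right) (simp_all add: below_idem below_red q)
  also have "\<dots> = proj A (idem w)"
    by (intro proj_idem_prefix q) simp
  finally show ?thesis .
qed

text \<open>In the presence of \<open>idem w\<close>, a path that stays inside the tree of \<open>w\<close> may be straightened. When
  the next letter \<open>x\<close> steps back along the last edge of the reduced path \<open>r @ [inv_letter x]\<close>, this
  leaves the detour \<open>[inv_letter x, x]\<close> after \<open>r\<close>. It is absorbed because \<open>r @ [inv_letter x]\<close> is a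
  vertex of the tree, so that \<open>idem w\<close> lies below the idempotent of this word.\<close>

lemma proj_idem_red:
  assumes "munn_tree v \<subseteq> munn_tree w" "w \<in> W" "v \<in> W"
  shows "proj A (idem w @ v) = proj A (idem w @ red v)"
  using assms
proof (induction v rule: rev_induct)
  case (snoc x v)
  note [simp] = idem_in and [simp del] = in_lists_conv_set
  have [simp]: "v \<in> W" "w \<in> W" and x [simp]: "x \<in> tilde A"
    using snoc.prems by (auto simp: in_lists_conv_set)
  have [simp]: "[x] \<in> W" using x by simp
  have sub: "munn_tree v \<subseteq> munn_tree w"
    using snoc.prems(1) unfolding munn_tree_append by blast
  have [simp]: "red v \<in> W" by (intro red_in_lists) simp
  have IH: "proj A ((idem w @ v) @ [x]) = proj A ((idem w @ red v) @ [x])"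
    using snoc.IH sub by (intro proj_cong_left) simp_all
  from red_snoc[of v x] show ?case
  proof (elim disjE exE conjE)
    assume "red (v @ [x]) = red v @ [x]"
    then show ?case using IH by simp
  next
    fix r assume r: "red v = r @ [inv_letter x]" "red (v @ [x]) = r"
    have [simp]: "r \<in> W" using \<open>red v \<in> W\<close> unfolding r by simp
    have e: "proj A (idem w @ idem (r @ [inv_letter x])) = proj A (idem w)"
      using sub red_in_munn_tree[of v] by (intro proj_idem_munn_tree) (auto simp: r)
    let ?f = "[inv_letter x, x]"
    have f: "?f = idem [inv_letter x]" by (simp add: idem_def)
    have [simp]: "[inv_letter x] \<in> W" using x by simp
    have "proj A (idem w @ r) = proj A ((idem w @ idem (r @ [inv_letter x])) @ r)"
      using e x by (intro proj_cong_left) simp_all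
    also have "\<dots> = proj A ((idem w @ r) @ idem [inv_letter x] @ idem (inv_word r) @ [])"
      by (simp add: idem_def inv_word_append)
    also have "\<dots> = proj A ((idem w @ r) @ idem (inv_word r) @ idem [inv_letter x] @ [])"
      by (intro proj_idem_commute) simp_all
    also have "\<dots> = proj A (idem w @ r @ idem (inv_word r) @ idem [inv_letter x])" by simp
    also have "\<dots> = proj A (idem w @ r @ idem [inv_letter x])"
      by (intro proj_idem_absorb_right) simp_all
    finally show ?case using IH r by (simp add: f[symmetric])
  qed
qed simp

lemma below_munn:
  assumes "munn_tree v \<subseteq> munn_tree u" "red u = red v" "u \<in> W" "v \<in> W"
  shows "below u v"
proof -
  have "proj A u = proj A (idem u @ u)"
    using assms below_refl[of u] by (simp add: below_def)
  also have "\<dots> = proj A (idem u @ v)"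
    using proj_idem_red[of u u] proj_idem_red[of v u] assms by simp
  finally show ?thesis using assms by (simp add: below_def)
qed

theorem munn:
  assumes "u \<in> W" "v \<in> W"
  shows "proj A u = proj A v \<longleftrightarrow> munn_tree u = munn_tree v \<and> red u = red v"
proof
  assume "proj A u = proj A v"
  then show "munn_tree u = munn_tree v \<and> red u = red v"
    using assms congruence_munn[of u v A] proj_eq_iff[of u A v] by blast
next
  assume "munn_tree u = munn_tree v \<and> red u = red v"
  then show "proj A u = proj A v"
    using assms by (intro below_antisym below_munn) auto
qed

end


section \<open>Sweeping transducers on a linearly bounded tape\<close>

text \<open>A nondeterministic letter-to-letter transducer reads \<open>xs\<close> and overwrites it by \<open>ys\<close>, leading
  from one state to another.\<close>

inductive run :: "('q \<times> 'c \<times> 'c \<times> 'q) set \<Rightarrow> 'q \<Rightarrow> 'c list \<Rightarrow> 'c list \<Rightarrow> 'q \<Rightarrow> bool"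
  for \<delta> where
  Nil: "run \<delta> q [] [] q"
| Cons: "(q, x, y, q') \<in> \<delta> \<Longrightarrow> run \<delta> q' xs ys q'' \<Longrightarrow> run \<delta> q (x # xs) (y # ys) q''"

lemma run_append:
  "run \<delta> q xs ys q' \<Longrightarrow> run \<delta> q' xs' ys' q'' \<Longrightarrow> run \<delta> q (xs @ xs') (ys @ ys') q''"
  by (induction rule: run.induct) (auto intro: run.intros)

lemma run_length: "run \<delta> q xs ys q' \<Longrightarrow> length ys = length xs"
  by (induction rule: run.induct) auto

definition sweep :: "('q \<times> 'c \<times> 'c \<times> 'q) set \<Rightarrow> 'q set \<Rightarrow> 'q set \<Rightarrow> 'c list \<Rightarrow> 'c list \<Rightarrow> bool" where
  "sweep \<delta> I F xs ys \<longleftrightarrow> (\<exists>q\<in>I. \<exists>q'\<in>F. run \<delta> q xs ys q')"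

text \<open>The bounded machine repeats sweeps: in state \<open>Home\<close> it stands on the left marker, it simulates
  the transducer on its way to the right marker, and goes back. From \<open>Home\<close> it may instead decide to
  check that every cell is accepting.\<close>

datatype 'q control = Home | Back | Check | Accept | Sweep 'q

locale sweeping_machine =
  fixes X :: "'s set" and Q :: "'q set" and \<Gamma> :: "'c set"
    and \<delta> :: "('q \<times> 'c \<times> 'c \<times> 'q) set" and I F :: "'q set" and Acc :: "'c set"
    and inp :: "'s \<Rightarrow> 'c"
    and enc_control :: "'q control \<Rightarrow> nat" and enc_cell :: "'c \<Rightarrow> nat"
  assumes finite_input: "finite X" and finite_states: "finite Q" and finite_cells: "finite \<Gamma>"
    and \<delta>: "\<delta> \<subseteq> Q \<times> \<Gamma> \<times> \<Gamma> \<times> Q" and I: "I \<subseteq> Q" and F: "F \<subseteq> Q"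
    and inp: "inp ` X \<subseteq> \<Gamma>"
    and inj_control: "inj_on enc_control ({Home, Back, Check, Accept} \<union> Sweep ` Q)"
    and inj_cell: "inj_on enc_cell \<Gamma>"
begin

text \<open>An input symbol already stands for the cell that it is to be encoded as, so that no separate
  pass is needed to initialise the tape.\<close>

inductive denotes :: "'s tape_symbol \<Rightarrow> 'c \<Rightarrow> bool" where
  read: "a \<in> X \<Longrightarrow> denotes (Input a) (inp a)"
| written: "c \<in> \<Gamma> \<Longrightarrow> denotes (Work (enc_cell c)) c"

lemma denotes_unique: "denotes s c \<Longrightarrow> denotes s c' \<Longrightarrow> c = c'"
  using inj_cell by (auto elim!: denotes.cases dest: inj_onD)

lemma not_denotes [simp]: "\<not> denotes LeftEnd c" "\<not> denotes RightEnd c"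
  by (auto elim: denotes.cases)

inductive_set program :: "('q control \<times> 's tape_symbol \<times> 'q control \<times> 's tape_symbol \<times> direction) set"
  where
  start_sweep: "q \<in> I \<Longrightarrow> (Home, LeftEnd, Sweep q, LeftEnd, GoRight) \<in> program"
| sweep: "(q, x, y, q') \<in> \<delta> \<Longrightarrow> denotes s x \<Longrightarrow>
    (Sweep q, s, Sweep q', Work (enc_cell y), GoRight) \<in> program"
| end_sweep: "q \<in> F \<Longrightarrow> (Sweep q, RightEnd, Back, RightEnd, GoLeft) \<in> program"
| go_back: "denotes s x \<Longrightarrow> (Back, s, Back, s, GoLeft) \<in> program"
| home: "(Back, LeftEnd, Home, LeftEnd, Stay) \<in> program"
| start_check: "(Home, LeftEnd, Check, LeftEnd, GoRight) \<in> program"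
| check: "denotes s x \<Longrightarrow> x \<in> Acc \<Longrightarrow> (Check, s, Check, s, GoRight) \<in> program"
| accept: "(Check, RightEnd, Accept, RightEnd, Stay) \<in> program"

definition control_states :: "'q control set" where
  "control_states = {Home, Back, Check, Accept} \<union> Sweep ` Q"

definition symbols :: "'s tape_symbol set" where
  "symbols = {LeftEnd, RightEnd, Blank} \<union> Input ` X \<union> (Work \<circ> enc_cell) ` \<Gamma>"

definition machine :: "'s turing_machine" where
  "machine =
     \<lparr>states = enc_control ` control_states,
      tape_alphabet = symbols,
      transitions = (\<lambda>(c, x, c', y, d). (enc_control c, x, enc_control c', y, d)) ` program,
      initial = enc_control Home,
      accepting = {enc_control Accept}\<rparr>"

lemma denotes_symbols: "denotes s c \<Longrightarrow> s \<in> symbols"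
  by (auto simp: symbols_def elim: denotes.cases)

lemma program_wf:
  assumes "(c, x, c', y, d) \<in> program"
  shows "c \<in> control_states \<and> c' \<in> control_states \<and> x \<in> symbols \<and> y \<in> symbols \<and>
    (x = LeftEnd \<longleftrightarrow> y = LeftEnd) \<and> (x = RightEnd \<longleftrightarrow> y = RightEnd) \<and>
    (x = LeftEnd \<longrightarrow> d \<noteq> GoLeft) \<and> (x = RightEnd \<longrightarrow> d \<noteq> GoRight)"
  using assms I F \<delta>
  by (cases rule: program.cases)
    (auto simp: control_states_def denotes_symbols, auto simp: symbols_def)

lemma bounded_machine: "bounded_machine X machine"
proof -
  have "finite (states machine)" "finite (tape_alphabet machine)"
    using finite_states finite_input finite_cells
    by (simp_all add: machine_def control_states_def symbols_def)
  moreover have "{LeftEnd, RightEnd, Blank} \<union> Input ` X \<subseteq> tape_alphabet machine"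
    by (auto simp: machine_def symbols_def)
  moreover have "initial machine \<in> states machine" "accepting machine \<subseteq> states machine"
    by (auto simp: machine_def control_states_def)
  moreover have "\<forall>(p, x, q, y, d) \<in> transitions machine.
        p \<in> states machine \<and> q \<in> states machine \<and> x \<in> tape_alphabet machine \<and>
        y \<in> tape_alphabet machine \<and>
        (x = LeftEnd \<longleftrightarrow> y = LeftEnd) \<and> (x = RightEnd \<longleftrightarrow> y = RightEnd) \<and>
        (x = LeftEnd \<longrightarrow> d \<noteq> GoLeft) \<and> (x = RightEnd \<longrightarrow> d \<noteq> GoRight)"
    using program_wf by (fastforce simp: machine_def)
  ultimately show ?thesis unfolding bounded_machine_def by blast
qed

lemma transitions_iff:
  assumes "c \<in> control_states"
  shows "(enc_control c, x, p, y, d) \<in> transitions machine \<longleftrightarrow>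
    (\<exists>c'. p = enc_control c' \<and> (c, x, c', y, d) \<in> program)"
proof
  assume "(enc_control c, x, p, y, d) \<in> transitions machine"
  then obtain c1 c' where c: "enc_control c = enc_control c1" "p = enc_control c'"
    and pr: "(c1, x, c', y, d) \<in> program"
    by (auto simp: machine_def)
  have "c1 = c"
    using inj_control c(1) assms program_wf[OF pr] unfolding control_states_def inj_on_def by metis
  with c pr show "\<exists>c'. p = enc_control c' \<and> (c, x, c', y, d) \<in> program" by blast
next
  assume "\<exists>c'. p = enc_control c' \<and> (c, x, c', y, d) \<in> program"
  then show "(enc_control c, x, p, y, d) \<in> transitions machine"
    by (force simp: machine_def)
qed

lemma step_programI:
  assumes "(c, x, c', y, d) \<in> program"
  shows "step machine (enc_control c, u @ x # v, length u) (enc_control c', u @ y # v, move d (length u))"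
proof -
  have "(enc_control c, (u @ x # v) ! length u, enc_control c', y, d) \<in> transitions machine"
    using transitions_iff[of c x "enc_control c'" y d] program_wf[OF assms] assms by auto
  from step.intros[OF this] show ?thesis by simp
qed

abbreviation tape :: "'s tape_symbol list \<Rightarrow> 's tape_symbol list" where
  "tape ss \<equiv> LeftEnd # ss @ [RightEnd]"

abbreviation reaches :: "'s configuration \<Rightarrow> 's configuration \<Rightarrow> bool" where
  "reaches \<equiv> (step machine)\<^sup>*\<^sup>*"

text \<open>The part \<open>u\<close> of the tape that has been swept grows in the induction.\<close>

lemma reaches_sweep:
  assumes "run \<delta> q xs ys q'" "list_all2 denotes ss xs"
  shows "\<exists>ss'. list_all2 denotes ss' ys \<and>
    reaches (enc_control (Sweep q), u @ ss @ [RightEnd], length u)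
      (enc_control (Sweep q'), u @ ss' @ [RightEnd], length u + length ss)"
  using assms
proof (induction arbitrary: ss u rule: run.induct)
  case (Cons q x y q' xs ys q'')
  then obtain s ss1 where ss: "ss = s # ss1" "denotes s x" "list_all2 denotes ss1 xs"
    by (auto simp: list_all2_Cons2)
  let ?y = "Work (enc_cell y)"
  from Cons.IH[OF ss(3), of "u @ [?y]"] obtain ss' where ss': "list_all2 denotes ss' ys"
    "reaches (enc_control (Sweep q'), u @ ?y # ss1 @ [RightEnd], Suc (length u))
      (enc_control (Sweep q''), u @ ?y # ss' @ [RightEnd], Suc (length u + length ss1))"
    by auto
  have "step machine (enc_control (Sweep q), u @ s # (ss1 @ [RightEnd]), length u)
      (enc_control (Sweep q'), u @ ?y # (ss1 @ [RightEnd]), move GoRight (length u))"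
    using Cons.hyps(1) ss(2) by (intro step_programI program.sweep)
  then have "reaches (enc_control (Sweep q), u @ ss @ [RightEnd], length u)
      (enc_control (Sweep q''), u @ (?y # ss') @ [RightEnd], length u + length ss)"
    using ss'(2) unfolding ss by (simp add: converse_rtranclp_into_rtranclp)
  moreover have "list_all2 denotes (?y # ss') (y # ys)"
    using ss'(1) Cons.hyps(1) \<delta> by (auto intro: denotes.written)
  ultimately show ?case by blast
qed auto

lemma reaches_check:
  assumes "xs \<in> lists Acc" "list_all2 denotes ss xs"
  shows "reaches (enc_control Check, u @ ss @ [RightEnd], length u)
      (enc_control Check, u @ ss @ [RightEnd], length u + length ss)"
  using assms
proof (induction xs arbitrary: ss u rule: list.induct)
  case (Cons x xs)
  then obtain s ss1 where ss: "ss = s # ss1" "denotes s x" "list_all2 denotes ss1 xs"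
    by (auto simp: list_all2_Cons2)
  have "step machine (enc_control Check, u @ s # (ss1 @ [RightEnd]), length u)
      (enc_control Check, u @ s # (ss1 @ [RightEnd]), move GoRight (length u))"
    by (rule step_programI, rule program.check[of _ x]) (use Cons.prems(1) ss(2) in simp_all)
  then show ?case
    using Cons.IH[OF _ ss(3), of "u @ [s]"] Cons.prems unfolding ss
    by (simp add: converse_rtranclp_into_rtranclp)
qed simp

lemma reaches_back:
  assumes "list_all2 denotes ss xs" "i \<le> length ss"
  shows "reaches (enc_control Back, tape ss, i) (enc_control Home, tape ss, 0)"
  using assms(2)
proof (induction i)
  case 0
  show ?case using step_programI[OF program.home, of "[]"] by auto
next
  case (Suc i)
  then have "denotes (ss ! i) (xs ! i)" using assms by (simp add: list_all2_nthD)
  then have "step machine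
      (enc_control Back, (LeftEnd # take i ss) @ ss ! i # (drop (Suc i) ss @ [RightEnd]),
        length (LeftEnd # take i ss))
      (enc_control Back, (LeftEnd # take i ss) @ ss ! i # (drop (Suc i) ss @ [RightEnd]),
        move GoLeft (length (LeftEnd # take i ss)))"
    by (intro step_programI program.go_back)
  moreover have "(LeftEnd # take i ss) @ ss ! i # (drop (Suc i) ss @ [RightEnd]) = tape ss"
    using Suc.prems id_take_nth_drop[of i ss] by simp
  ultimately have "step machine (enc_control Back, tape ss, Suc i) (enc_control Back, tape ss, i)"
    using Suc.prems by (simp only:) simp
  with Suc show ?case by (simp add: converse_rtranclp_into_rtranclp)
qed

lemma reaches_sweeps:
  assumes "(sweep \<delta> I F)\<^sup>*\<^sup>* xs ys" "list_all2 denotes ss xs"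
  shows "\<exists>ss'. list_all2 denotes ss' ys \<and>
    reaches (enc_control Home, tape ss, 0) (enc_control Home, tape ss', 0)"
  using assms
proof (induction rule: rtranclp_induct)
  case base
  then show ?case by blast
next
  case (step ys zs)
  then obtain ss1 where ss1: "list_all2 denotes ss1 ys"
      "reaches (enc_control Home, tape ss, 0) (enc_control Home, tape ss1, 0)"
    by blast
  obtain q q' where q: "q \<in> I" "q' \<in> F" "run \<delta> q ys zs q'"
    using step.hyps by (auto simp: sweep_def)
  obtain ss2 where ss2: "list_all2 denotes ss2 zs"
    "reaches (enc_control (Sweep q), tape ss1, 1) (enc_control (Sweep q'), tape ss2, Suc (length ss2))"
  proof -
    obtain ss2 where ss2: "list_all2 denotes ss2 zs"
      "reaches (enc_control (Sweep q), tape ss1, 1) (enc_control (Sweep q'), tape ss2, Suc (length ss1))"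
      using reaches_sweep[OF q(3) ss1(1), of "[LeftEnd]"] by auto
    moreover have "length ss2 = length ss1"
      using run_length[OF q(3)] list_all2_lengthD[OF ss1(1)] list_all2_lengthD[OF ss2(1)] by simp
    ultimately show ?thesis using that by metis
  qed
  have "reaches (enc_control Home, tape ss1, 0) (enc_control (Sweep q), tape ss1, 1)"
    using step_programI[OF program.start_sweep[OF q(1)], of "[]"] by auto
  moreover have "reaches (enc_control (Sweep q'), tape ss2, Suc (length ss2))
      (enc_control Back, tape ss2, length ss2)"
    using step_programI[OF program.end_sweep[OF q(2)], of "LeftEnd # ss2" "[]"] by auto
  ultimately have "reaches (enc_control Home, tape ss, 0) (enc_control Home, tape ss2, 0)"
    using ss1(2) ss2(2) reaches_back[OF ss2(1) order.refl] by (meson rtranclp_trans)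
  with ss2(1) show ?case by blast
qed

lemma reaches_accept:
  assumes "list_all2 denotes ss ys" "ys \<in> lists Acc"
  shows "reaches (enc_control Home, tape ss, 0) (enc_control Accept, tape ss, Suc (length ss))"
proof -
  have "reaches (enc_control Home, tape ss, 0) (enc_control Check, tape ss, 1)"
    using step_programI[OF program.start_check, of "[]"] by auto
  moreover have "reaches (enc_control Check, tape ss, 1) (enc_control Check, tape ss, Suc (length ss))"
    using reaches_check[OF assms(2,1), of "[LeftEnd]"] by simp
  moreover have "reaches (enc_control Check, tape ss, Suc (length ss))
      (enc_control Accept, tape ss, Suc (length ss))"
    using step_programI[OF program.accept, of "LeftEnd # ss" "[]"] by auto
  ultimately show ?thesis by (meson rtranclp_trans)
qed

text \<open>An invariant of all configurations reachable from input \<open>xs0\<close>. During a sweep the tape holds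
  the output \<open>ys1\<close> of the part \<open>xs1\<close> already read, followed by the unread rest of the word that
  the sweep started from.\<close>

inductive shape :: "'c list \<Rightarrow> 's configuration \<Rightarrow> bool" for xs0 where
  Home: "(sweep \<delta> I F)\<^sup>*\<^sup>* xs0 xs \<Longrightarrow> list_all2 denotes ss xs \<Longrightarrow>
    shape xs0 (enc_control Home, tape ss, 0)"
| Back: "(sweep \<delta> I F)\<^sup>*\<^sup>* xs0 xs \<Longrightarrow> list_all2 denotes ss xs \<Longrightarrow> i \<le> length ss \<Longrightarrow>
    shape xs0 (enc_control Back, tape ss, i)"
| Check: "(sweep \<delta> I F)\<^sup>*\<^sup>* xs0 (xs1 @ xs2) \<Longrightarrow> xs1 \<in> lists Acc \<Longrightarrow>
    list_all2 denotes ss1 xs1 \<Longrightarrow> list_all2 denotes ss2 xs2 \<Longrightarrow>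
    shape xs0 (enc_control Check, tape (ss1 @ ss2), Suc (length ss1))"
| Accept: "(sweep \<delta> I F)\<^sup>*\<^sup>* xs0 xs \<Longrightarrow> xs \<in> lists Acc \<Longrightarrow>
    shape xs0 (enc_control Accept, t, i)"
| Sweep: "(sweep \<delta> I F)\<^sup>*\<^sup>* xs0 (xs1 @ xs2) \<Longrightarrow> q0 \<in> I \<Longrightarrow> q \<in> Q \<Longrightarrow> run \<delta> q0 xs1 ys1 q \<Longrightarrow>
    list_all2 denotes ss1 ys1 \<Longrightarrow> list_all2 denotes ss2 xs2 \<Longrightarrow>
    shape xs0 (enc_control (Sweep q), tape (ss1 @ ss2), Suc (length ss1))"

lemma shape_step:
  assumes "shape xs0 C" "step machine C C'"
  shows "shape xs0 C'"
proof -
  have step_cases: "\<exists>c' y d. C' = (enc_control c', t[i := y], move d i) \<and> (c, t ! i, c', y, d) \<in> program"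
    if C: "C = (enc_control c, t, i)" and c: "c \<in> control_states" for c t i
  proof -
    from assms(2) obtain p y d where "C' = (p, t[i := y], move d i)"
      "(enc_control c, t ! i, p, y, d) \<in> transitions machine"
      unfolding C by (auto elim: step.cases)
    then show ?thesis using transitions_iff[OF c] by blast
  qed
  from assms(1) show ?thesis
  proof cases
    case (Home xs ss)
    from step_cases[OF Home(1)] obtain c' y d
      where C': "C' = (enc_control c', (tape ss)[0 := y], move d 0)"
        and pr: "(Home, LeftEnd, c', y, d) \<in> program"
      by (auto simp: control_states_def)
    from pr show ?thesis
    proof cases
      case (start_sweep q)
      moreover have "shape xs0 (enc_control (Sweep q), tape ss, Suc 0)"
        using shape.Sweep[of xs0 "[]" xs q q "[]" "[]" ss] Home I start_sweep
        by (auto intro: run.Nil)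
      ultimately show ?thesis using C' by simp
    next
      case start_check
      moreover have "shape xs0 (enc_control Check, tape ss, Suc 0)"
        using shape.Check[of xs0 "[]" xs "[]" ss] Home by auto
      ultimately show ?thesis using C' by simp
    qed
  next
    case (Back xs ss i)
    from step_cases[OF Back(1)] obtain c' y d
      where C': "C' = (enc_control c', (tape ss)[i := y], move d i)"
        and pr: "(Back, tape ss ! i, c', y, d) \<in> program"
      by (auto simp: control_states_def)
    have yt: "(tape ss)[i := tape ss ! i] = tape ss" by (rule list_update_id)
    from pr show ?thesis
    proof cases
      case (go_back x)
      then show ?thesis
        using shape.Back[OF Back(2,3), of "i - 1"] Back(4) C' yt by simp
    next
      case home
      have "i = 0"
      proof (rule ccontr)
        assume "i \<noteq> 0"
        then have "tape ss ! i = ss ! (i - 1)" "i - 1 < length ss"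
          using Back(4) by (auto simp: nth_append)
        then show False using home list_all2_nthD[OF Back(3), of "i - 1"] by simp
      qed
      then show ?thesis using shape.Home[OF Back(2,3)] C' home by simp
    qed
  next
    case (Check xs1 xs2 ss1 ss2)
    from step_cases[OF Check(1)] obtain c' y d
      where C': "C' = (enc_control c', (tape (ss1 @ ss2))[Suc (length ss1) := y], move d (Suc (length ss1)))"
        and pr: "(Check, tape (ss1 @ ss2) ! Suc (length ss1), c', y, d) \<in> program"
      by (auto simp: control_states_def)
    show ?thesis
    proof (cases ss2)
      case Nil
      with pr have "(Check, RightEnd, c', y, d) \<in> program" by (simp add: nth_append)
      then show ?thesis
      proof cases
        case accept
        then show ?thesis using C' shape.Accept[OF Check(2)] Check(3,5) Nil by auto
      qed auto
    next
      case (Cons s ss3)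
      then obtain x xs3 where xs2: "xs2 = x # xs3" "denotes s x" "list_all2 denotes ss3 xs3"
        using Check(5) by (auto simp: list_all2_Cons1)
      from pr Cons have "(Check, s, c', y, d) \<in> program" by (simp add: nth_append)
      then show ?thesis
      proof cases
        case (check x')
        then have "x' = x" using xs2(2) denotes_unique by blast
        then show ?thesis
          using shape.Check[of xs0 "xs1 @ [x]" xs3 "ss1 @ [s]" ss3] Check xs2 check C' Cons
          by (auto intro: list_all2_appendI)
      qed (use xs2 in auto)
    qed
  next
    case (Accept xs t i)
    from step_cases[OF Accept(1)] obtain c' y d where "(Accept, t ! i, c', y, d) \<in> program"
      by (auto simp: control_states_def)
    then show ?thesis by cases
  next
    case (Sweep xs1 xs2 q0 q ys1 ss1 ss2)
    from step_cases[OF Sweep(1)] Sweep(4) obtain c' y d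
      where C': "C' = (enc_control c', (tape (ss1 @ ss2))[Suc (length ss1) := y], move d (Suc (length ss1)))"
        and pr: "(Sweep q, tape (ss1 @ ss2) ! Suc (length ss1), c', y, d) \<in> program"
      by (auto simp: control_states_def)
    show ?thesis
    proof (cases ss2)
      case Nil
      with pr have "(Sweep q, RightEnd, c', y, d) \<in> program" by (simp add: nth_append)
      then show ?thesis
      proof cases
        case end_sweep
        have "sweep \<delta> I F xs1 ys1"
          using Sweep(3,5) end_sweep by (auto simp: sweep_def)
        then have "(sweep \<delta> I F)\<^sup>*\<^sup>* xs0 ys1"
          using Sweep(2,7) Nil by (simp add: rtranclp.rtrancl_into_rtrancl)
        then show ?thesis using C' shape.Back[OF _ Sweep(6), where i = "length ss1"] end_sweep Nil by simp
      qed auto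
    next
      case (Cons s ss3)
      then obtain x xs3 where xs2: "xs2 = x # xs3" "denotes s x" "list_all2 denotes ss3 xs3"
        using Sweep(7) by (auto simp: list_all2_Cons1)
      from pr Cons have "(Sweep q, s, c', y, d) \<in> program" by (simp add: nth_append)
      then show ?thesis
      proof cases
        case (sweep x' z q')
        then have [simp]: "x' = x" using xs2(2) denotes_unique by blast
        have "run \<delta> q0 (xs1 @ [x]) (ys1 @ [z]) q'"
          using Sweep(5) sweep by (auto intro: run_append run.intros)
        moreover have "z \<in> \<Gamma>" "q' \<in> Q" using sweep \<delta> by auto
        ultimately show ?thesis
          using shape.Sweep[of xs0 "xs1 @ [x]" xs3 q0 q' "ys1 @ [z]" "ss1 @ [y]" ss3] Sweep xs2 sweep C' Cons
          by (auto intro: list_all2_appendI denotes.written)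
      qed (use xs2 in auto)
    qed
  qed
qed

lemma accepted_language:
  "accepted_language X machine 0 =
     {w \<in> lists X. \<exists>ys\<in>lists Acc. (sweep \<delta> I F)\<^sup>*\<^sup>* (map inp w) ys}"
proof -
  have "(\<exists>q t i. (step machine)\<^sup>*\<^sup>* (initial_configuration machine 0 w) (q, t, i) \<and> q \<in> accepting machine) \<longleftrightarrow>
      (\<exists>ys\<in>lists Acc. (sweep \<delta> I F)\<^sup>*\<^sup>* (map inp w) ys)" if w: "w \<in> lists X" for w
  proof -
    have init: "initial_configuration machine 0 w = (enc_control Home, tape (map Input w), 0)"
      by (simp add: initial_configuration_def machine_def)
    have acc: "accepting machine = {enc_control Accept}" by (simp add: machine_def)
    have den: "list_all2 denotes (map Input w) (map inp w)"
      using w by (induction w) (auto intro: denotes.read)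
    show ?thesis
    proof
      assume "\<exists>q t i. (step machine)\<^sup>*\<^sup>* (initial_configuration machine 0 w) (q, t, i) \<and> q \<in> accepting machine"
      then obtain t i where "reaches (enc_control Home, tape (map Input w), 0) (enc_control Accept, t, i)"
        by (auto simp: init acc)
      then have "shape (map inp w) (enc_control Accept, t, i)"
        by (induction rule: rtranclp_induct)
          (auto intro: shape_step shape.Home[OF rtranclp.rtrancl_refl den])
      then show "\<exists>ys\<in>lists Acc. (sweep \<delta> I F)\<^sup>*\<^sup>* (map inp w) ys"
      proof cases
        case (Accept xs)
        then show ?thesis by blast
      qed (use inj_control in \<open>auto simp: inj_on_def\<close>)
    next
      assume "\<exists>ys\<in>lists Acc. (sweep \<delta> I F)\<^sup>*\<^sup>* (map inp w) ys"
      then obtain ys ss where ys: "ys \<in> lists Acc" "list_all2 denotes ss ys"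
        "reaches (enc_control Home, tape (map Input w), 0) (enc_control Home, tape ss, 0)"
        using reaches_sweeps[OF _ den] by blast
      then have "reaches (enc_control Home, tape (map Input w), 0)
        (enc_control Accept, tape ss, Suc (length ss))"
        using reaches_accept by (meson rtranclp_trans)
      then show "\<exists>q t i. (step machine)\<^sup>*\<^sup>* (initial_configuration machine 0 w) (q, t, i) \<and> q \<in> accepting machine"
        unfolding init acc by auto
    qed
  qed
  then show ?thesis unfolding accepted_language_def by blast
qed

end

text \<open>Iterated sweeps over the cells of the input are linear-bounded computations. This is the only
  place where Turing machines are programmed: everything else is done with words of cells.\<close>

theorem context_sensitive_sweep:
  fixes inp :: "'s \<Rightarrow> 'c"
  assumes "finite X" "finite Q" "finite \<Gamma>" "\<delta> \<subseteq> Q \<times> \<Gamma> \<times> \<Gamma> \<times> Q" "I \<subseteq> Q" "F \<subseteq> Q" "inp ` X \<subseteq> \<Gamma>"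
  shows "context_sensitive_language X
    {w \<in> lists X. \<exists>ys\<in>lists Acc. (sweep \<delta> I F)\<^sup>*\<^sup>* (map inp w) ys}"
proof -
  have "finite ({Home, Back, Check, Accept} \<union> Sweep ` Q)" using assms by simp
  then obtain enc_control :: "_ \<Rightarrow> nat" where 1: "inj_on enc_control ({Home, Back, Check, Accept} \<union> Sweep ` Q)"
    using finite_imp_inj_to_nat_seg by metis
  obtain enc_cell :: "_ \<Rightarrow> nat" where 2: "inj_on enc_cell \<Gamma>"
    using finite_imp_inj_to_nat_seg[OF assms(3)] by metis
  interpret sweeping_machine X Q \<Gamma> \<delta> I F Acc inp enc_control enc_cell
    using assms 1 2 by unfold_locales
  show ?thesis
    unfolding context_sensitive_language_def
    using bounded_machine accepted_language by metis
qed


section \<open>A sweeping transducer for the equaliser of two word homomorphisms\<close>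

lemma run_nth:
  assumes "length ys = length xs" "\<And>m. m < length xs \<Longrightarrow> (st m, xs ! m, ys ! m, st (Suc m)) \<in> \<delta>"
  shows "run \<delta> (st 0) xs ys (st (length xs))"
  using assms
proof (induction xs arbitrary: ys st)
  case (Cons x xs)
  then obtain y ys' where ys: "ys = y # ys'" by (cases ys) auto
  have "run \<delta> (st (Suc 0)) xs ys' (st (Suc (length xs)))"
    using Cons.prems by (intro Cons.IH[of ys' "\<lambda>m. st (Suc m)"]) (force simp: ys)+
  then show ?case
    using Cons.prems(2)[of 0] by (auto simp: ys intro: run.Cons)
qed (auto intro: run.Nil)

text \<open>The cell of an input letter \<open>x\<close>. Booleans name the two homomorphisms \<open>g False\<close> and \<open>g True\<close>.
  A pair \<open>(b, p)\<close> in \<open>todo\<close>, with \<open>p\<close> a prefix of \<open>g b x\<close>, stands for the prefix of the image of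
  the whole input under \<open>g b\<close> that ends with this occurrence of \<open>p\<close>; its vertex has still to be
  found in the other Munn tree. On each of two tracks, the scratch words of the cells are pieces of
  one long word, which is reduced in place.\<close>

datatype ('s, 'a) cell =
  Cell (label: 's) (todo: "(bool \<times> 'a letter list) set") (scratch: "bool \<Rightarrow> 'a letter list")

text \<open>A sweep either reduces or prepares a comparison. \<open>Reduce a\<close> remembers letters that have been
  taken out of cells to the left and not yet been cancelled; \<open>Choose d\<close> remembers for each track
  whether the end of the chosen prefix has been passed.\<close>

datatype 'a sweep_state = Reduce "bool \<Rightarrow> 'a letter list" | Choose "bool \<Rightarrow> bool"

locale two_homs =
  fixes X :: "'s set" and A :: "'a set" and g :: "bool \<Rightarrow> 's \<Rightarrow> 'a letter list" and K :: nat
  assumes finite_X: "finite X" and finite_A: "finite A"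
    and g: "\<And>b x. x \<in> X \<Longrightarrow> g b x \<in> lists (tilde A)"
    and length_g: "\<And>b x. x \<in> X \<Longrightarrow> length (g b x) \<le> K"
    and K: "1 \<le> K"
begin

definition short :: "'a letter list set" where
  "short = {w. set w \<subseteq> tilde A \<and> length w \<le> K}"

definition extend :: "bool \<Rightarrow> 's list \<Rightarrow> 'a letter list" where
  "extend b w = concat (map (g b) w)"

text \<open>One step of a reducing sweep on one track: the word carried in and the content of the cell are
  replaced by any new content and word carried out with the same product in the free group. A whole
  sweep then satisfies the same equation, and a cancelling pair can be brought together across any
  number of empty cells.\<close>

definition carry :: "('a letter list \<times> 'a letter list \<times> 'a letter list \<times> 'a letter list) set" where
  "carry = {(a, c, c', a'). a \<in> short \<and> c \<in> short \<and> c' \<in> short \<and> a' \<in> short \<and>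
     red (a @ c) = red (c' @ a')}"

definition prefixes_of :: "'s \<Rightarrow> (bool \<times> 'a letter list) set" where
  "prefixes_of x = {(b, p). prefix p (g b x)}"

definition cells :: "('s, 'a) cell set" where
  "cells = {Cell x P s | x P s. x \<in> X \<and> P \<subseteq> prefixes_of x \<and> (\<forall>b. s b \<in> short)}"

text \<open>A choosing sweep starts from empty tracks, writes a prefix of the image of the input on each of
  them, and at once removes both prefixes from \<open>todo\<close>. This is done in advance of the verification:
  no further choosing sweep and no acceptance is possible before both tracks are empty again, and
  reducing sweeps can achieve that only if the two prefixes are equal in the free group.\<close>

inductive_set rules ::
  "('a sweep_state \<times> ('s, 'a) cell \<times> ('s, 'a) cell \<times> 'a sweep_state) set" where
  reduce: "x \<in> X \<Longrightarrow> P \<subseteq> prefixes_of x \<Longrightarrow> (\<And>b. (a b, s b, s' b, a' b) \<in> carry) \<Longrightarrow>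
    (Reduce a, Cell x P s, Cell x P s', Reduce a') \<in> rules"
| choose: "x \<in> X \<Longrightarrow> P \<subseteq> prefixes_of x \<Longrightarrow>
    (\<And>b. if d b then d' b \<and> s b = [] else if d' b then prefix (s b) (g b x) else s b = g b x) \<Longrightarrow>
    (Choose d, Cell x P (\<lambda>_. []),
     Cell x (P - {(b, s b) | b. \<not> d b \<and> d' b}) s, Choose d') \<in> rules"

definition control :: "'a sweep_state set" where
  "control = Reduce ` {a. \<forall>b. a b \<in> short} \<union> range Choose"

text \<open>A reducing sweep may start and end with a common word carried on both tracks: this multiplies
  both tracks by the same group element and leaves their equality unaffected. Starting with the
  inverse of a letter can delete that letter from the front of both tracks.\<close>

definition starts :: "'a sweep_state set" where
  "starts = insert (Choose (\<lambda>_. False)) (Reduce ` {a. (\<forall>b. a b \<in> short) \<and> a False = a True})"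

definition ends :: "'a sweep_state set" where
  "ends = insert (Choose (\<lambda>_. True)) (Reduce ` {a. (\<forall>b. a b \<in> short) \<and> a False = a True})"

text \<open>Initially the tracks hold the full images, so that their equality in the free group is the
  first thing to be verified.\<close>

definition encode :: "'s \<Rightarrow> ('s, 'a) cell" where
  "encode x = Cell x (prefixes_of x) (\<lambda>b. g b x)"

definition cleared :: "('s, 'a) cell set" where
  "cleared = {c. scratch c = (\<lambda>_. [])}"

definition finished :: "('s, 'a) cell set" where
  "finished = {c \<in> cleared. todo c = {}}"

abbreviation sweeps where "sweeps \<equiv> (sweep rules starts ends)\<^sup>*\<^sup>*"

lemma finite_short: "finite short"
  using finite_lists_length_le[of "tilde A" K] finite_A by (simp add: short_def tilde_def)

lemma finite_short_fun: "finite {a. \<forall>b::bool. a b \<in> short}"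
proof (rule finite_subset)
  show "{a. \<forall>b. a b \<in> short} \<subseteq> (\<lambda>(u, v) b. if b then u else v) ` (short \<times> short)"
  proof
    fix a :: "bool \<Rightarrow> 'a letter list" assume "a \<in> {a. \<forall>b. a b \<in> short}"
    moreover have "a = (\<lambda>b. if b then a True else a False)"
    proof
      fix b show "a b = (if b then a True else a False)" by (cases b) simp_all
    qed
    ultimately show "a \<in> (\<lambda>(u, v) b. if b then u else v) ` (short \<times> short)"
      by (intro image_eqI[of _ _ "(a True, a False)"]) auto
  qed
qed (simp add: finite_short)

lemma finite_control: "finite control"
  unfolding control_def using finite_short_fun by simp

lemma finite_prefixes_of: "finite (prefixes_of x)"
proof (rule finite_subset)
  show "prefixes_of x \<subseteq> (\<Union>b\<in>UNIV. Pair b ` set (prefixes (g b x)))"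
    by (fastforce simp: prefixes_of_def)
qed simp

lemma finite_cells: "finite cells"
proof (rule finite_subset)
  show "cells \<subseteq> (\<Union>x\<in>X. \<Union>P\<in>Pow (prefixes_of x). Cell x P ` {s. \<forall>b. s b \<in> short})"
    by (auto simp: cells_def)
  show "finite (\<Union>x\<in>X. \<Union>P\<in>Pow (prefixes_of x). Cell x P ` {s. \<forall>b. s b \<in> short})"
    using finite_X finite_prefixes_of finite_short_fun by auto
qed

lemma Nil_short: "[] \<in> short"
  by (simp add: short_def)

lemma g_short: "x \<in> X \<Longrightarrow> prefix p (g b x) \<Longrightarrow> p \<in> short"
  using g[of x b] length_g[of x b] by (fastforce simp: short_def prefix_def)

lemma rules_subset: "rules \<subseteq> control \<times> cells \<times> cells \<times> control"
proof -
  have "(q, c, c', q') \<in> control \<times> cells \<times> cells \<times> control" if "(q, c, c', q') \<in> rules" for q c c' q'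
    using that
  proof cases
    case (reduce x P a s s' a')
    then show ?thesis by (auto simp: control_def cells_def carry_def)
  next
    case (choose x P d d' s)
    have "s b \<in> short" for b
      using choose(7)[of b] g_short[OF choose(5), of "s b" b] Nil_short by (auto split: if_splits)
    then show ?thesis using choose Nil_short by (auto simp: control_def cells_def)
  qed
  then show ?thesis by auto
qed

lemma encode_cells: "encode ` X \<subseteq> cells"
  by (auto simp: encode_def cells_def intro: g_short[OF _ prefix_order.refl])


section \<open>Accepted words lie in the equaliser\<close>

definition track :: "bool \<Rightarrow> ('s, 'a) cell list \<Rightarrow> 'a letter list" where
  "track b cs = concat (map (\<lambda>c. scratch c b) cs)"

definition settled :: "('s, 'a) cell list \<Rightarrow> bool" where
  "settled cs \<longleftrightarrow> red (track False cs) = red (track True cs)"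

definition matched :: "'s list \<Rightarrow> nat \<Rightarrow> bool \<times> 'a letter list \<Rightarrow> bool" where
  "matched w i = (\<lambda>(b, p). red (extend b (take i w) @ p) \<in> munn_tree (extend (\<not> b) w))"

text \<open>Entries are removed from \<open>todo\<close> before they are verified, so what is known about them is
  conditional on the two tracks being equal in the free group. Empty tracks fulfil the condition.\<close>

definition invariant :: "'s list \<Rightarrow> ('s, 'a) cell list \<Rightarrow> bool" where
  "invariant w cs \<longleftrightarrow> map label cs = w \<and>
     (settled cs \<longrightarrow> red (extend False w) = red (extend True w) \<and>
       (\<forall>i < length w. \<forall>r \<in> prefixes_of (w ! i) - todo (cs ! i). matched w i r))"

text \<open>The equation that defines \<open>carry\<close> propagates along the run.\<close>

lemma run_Reduce:
  assumes "run rules (Reduce a) cs cs' q'"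
  shows "\<exists>a'. q' = Reduce a' \<and> map label cs' = map label cs \<and> map todo cs' = map todo cs \<and>
    (\<forall>b. red (a b @ track b cs) = red (track b cs' @ a' b))"
  using assms
proof (induction "Reduce a" cs cs' q' arbitrary: a rule: run.induct)
  case (Cons c c' q' cs cs' q'')
  from Cons.hyps(1) obtain a1 x P s s' where q': "q' = Reduce a1" "c = Cell x P s" "c' = Cell x P s'"
    and ca: "\<And>b. red (a b @ s b) = red (s' b @ a1 b)"
    by (auto elim!: rules.cases simp: carry_def)
  from Cons.hyps(3)[OF q'(1)] obtain a' where a': "q'' = Reduce a'" "map label cs' = map label cs"
      "map todo cs' = map todo cs" "\<And>b. red (a1 b @ track b cs) = red (track b cs' @ a' b)"
    by auto
  have "red (a b @ track b (c # cs)) = red (track b (c' # cs') @ a' b)" for b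
  proof -
    have "red (a b @ s b @ track b cs) = red ((a b @ s b) @ track b cs)" by simp
    also have "\<dots> = red ((s' b @ a1 b) @ track b cs)"
      by (intro red_append_cong ca HOL.refl)
    also have "\<dots> = red (s' b @ (a1 b @ track b cs))" by simp
    also have "\<dots> = red (s' b @ (track b cs' @ a' b))"
      by (intro red_append_cong a' HOL.refl)
    finally show ?thesis by (simp add: track_def q')
  qed
  with a' q' show ?case by auto
qed (auto simp: track_def)

text \<open>The effect on one track \<open>b\<close>: a prefix of the image, ending at some \<open>p\<close> in some cell \<open>i\<close>, is
  written, and the corresponding entry is the only one removed. The case \<open>d b\<close> describes the cells
  beyond the end of the prefix.\<close>

lemma run_Choose:
  assumes "run rules (Choose d) cs cs' (Choose (\<lambda>_. True))"
  shows "map label cs' = map label cs \<and> track b cs = [] \<and>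
    (if d b then track b cs' = [] \<and>
        (\<forall>j < length cs. \<forall>p. (b, p) \<in> todo (cs ! j) \<longrightarrow> (b, p) \<in> todo (cs' ! j))
     else \<exists>i < length cs. \<exists>p. prefix p (g b (label (cs ! i))) \<and>
        track b cs' = extend b (take i (map label cs)) @ p \<and>
        (\<forall>j < length cs. \<forall>r. (b, r) \<in> todo (cs ! j) \<longrightarrow> (b, r) \<in> todo (cs' ! j) \<or> j = i \<and> r = p))"
  using assms
proof (induction "Choose d :: 'a sweep_state" cs cs' "Choose (\<lambda>_. True) :: 'a sweep_state" arbitrary: d rule: run.induct)
  case (Cons c c' q' cs cs')
  from Cons.hyps(1) obtain d' x P s where q': "q' = Choose d'" "c = Cell x P (\<lambda>_. [])"
      "c' = Cell x (P - {(b, s b) | b. \<not> d b \<and> d' b}) s"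
    and s: "\<And>b. if d b then d' b \<and> s b = [] else if d' b then prefix (s b) (g b x) else s b = g b x"
    by (auto elim!: rules.cases)
  note IH = Cons.hyps(3)[OF q'(1)]
  have base: "map label (c' # cs') = map label (c # cs)" "track b (c # cs) = []"
    using IH q' by (auto simp: track_def)
  consider "d b" | "\<not> d b" "d' b" | "\<not> d b" "\<not> d' b" by blast
  then show ?case
  proof cases
    case 1
    then have d': "d' b" and sb: "s b = []" using s[of b] by auto
    have *: "(b, p) \<in> todo ((c' # cs') ! j)" if "j < length (c # cs)" "(b, p) \<in> todo ((c # cs) ! j)" for j p
      using that IH d' 1 q' by (cases j) auto
    show ?thesis using base 1 IH d' sb q' * by (auto simp: track_def)
  next
    case 2
    then have sb: "prefix (s b) (g b x)" using s[of b] by auto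
    have "(b, r) \<in> todo ((c' # cs') ! j) \<or> j = 0 \<and> r = s b"
      if "j < length (c # cs)" "(b, r) \<in> todo ((c # cs) ! j)" for j r
      using that IH 2 q' by (cases j) auto
    moreover have "track b (c' # cs') = extend b (take 0 (map label (c # cs))) @ s b"
      using IH 2 q' by (auto simp: track_def extend_def)
    moreover have "prefix (s b) (g b (label ((c # cs) ! 0)))" using sb q' by simp
    ultimately show ?thesis using base 2 by (auto simp del: nth.simps)
  next
    case 3
    then have sb: "s b = g b x" using s[of b] by auto
    from IH 3 obtain i p where i: "i < length cs" "prefix p (g b (label (cs ! i)))"
      "track b cs' = extend b (take i (map label cs)) @ p"
      "\<And>j r. j < length cs \<Longrightarrow> (b, r) \<in> todo (cs ! j) \<Longrightarrow> (b, r) \<in> todo (cs' ! j) \<or> j = i \<and> r = p"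
      by auto
    have "(b, r) \<in> todo ((c' # cs') ! j) \<or> j = Suc i \<and> r = p"
      if "j < length (c # cs)" "(b, r) \<in> todo ((c # cs) ! j)" for j r
      using that i 3 q' by (cases j) auto
    moreover have "track b (c' # cs') = extend b (take (Suc i) (map label (c # cs))) @ p"
      using i sb q' by (auto simp: track_def extend_def)
    moreover have "prefix p (g b (label ((c # cs) ! Suc i)))" "Suc i < length (c # cs)" using i by auto
    ultimately show ?thesis using base 3 by (auto simp del: nth.simps)
  qed
qed (auto simp: track_def)

lemma prefix_extend:
  assumes "i < length w" "prefix p (g b (w ! i))"
  shows "prefix (extend b (take i w) @ p) (extend b w)"
proof -
  have "extend b w = extend b (take i w) @ g b (w ! i) @ extend b (drop (Suc i) w)"
    by (subst id_take_nth_drop[OF assms(1)]) (simp add: extend_def)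
  then show ?thesis using assms(2) by (simp add: prefix_def) (metis append_assoc)
qed

lemma invariant_sweep:
  assumes "sweep rules starts ends cs cs'" "invariant w cs"
  shows "invariant w cs'"
proof -
  from assms(1) obtain q q' where q: "q \<in> starts" "q' \<in> ends" "run rules q cs cs' q'"
    by (auto simp: sweep_def)
  from assms(2) have w: "map label cs = w" by (simp add: invariant_def)
  show ?thesis
  proof (cases q)
    case (Reduce a)
    from run_Reduce[OF q(3)[unfolded Reduce]] obtain a' where a': "q' = Reduce a'"
      "map label cs' = map label cs" "map todo cs' = map todo cs"
      "\<And>b. red (a b @ track b cs) = red (track b cs' @ a' b)"
      by auto
    have eq: "a False = a True" "a' False = a' True"
      using q(1,2) Reduce a'(1) by (auto simp: starts_def ends_def)
    have "settled cs' = settled cs"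
      using red_right_cancel[of "track False cs'" "a' False" "track True cs'"]
        red_left_cancel[of "a False" "track False cs" "track True cs"] a'(4)[of True] a'(4)[of False]
      unfolding settled_def by (simp add: eq)
    moreover have "todo (cs' ! i) = todo (cs ! i)" if "i < length w" for i
      using that a'(2,3) w by (metis length_map nth_map)
    ultimately show ?thesis using assms(2) a'(2) by (auto simp: invariant_def)
  next
    case (Choose d)
    have d: "d = (\<lambda>_. False)" using q(1) Choose by (auto simp: starts_def)
    have "q' = Choose (\<lambda>_. True)"
    proof (cases q')
      case (Reduce a)
      have "\<not> run rules (Choose d) cs cs' (Reduce a)" for d
      proof
        assume "run rules (Choose d) cs cs' (Reduce a)"
        then show False
          by (induction "Choose d :: 'a sweep_state" cs cs' "Reduce a" arbitrary: d rule: run.induct)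
            (auto elim!: rules.cases)
      qed
      then show ?thesis using q(3) Reduce Choose by blast
    qed (use q(2) in \<open>auto simp: ends_def\<close>)
    then have run: "run rules (Choose (\<lambda>_. False)) cs cs' (Choose (\<lambda>_. True))"
      using q(3) Choose d by simp
    have "\<exists>i p. i < length cs \<and> prefix p (g b (label (cs ! i))) \<and>
        track b cs' = extend b (take i (map label cs)) @ p \<and>
        (\<forall>j < length cs. \<forall>r. (b, r) \<in> todo (cs ! j) \<longrightarrow> (b, r) \<in> todo (cs' ! j) \<or> j = i \<and> r = p)" for b
      using run_Choose[OF run, of b] by auto
    then obtain i p where ip: "\<And>b. i b < length cs" "\<And>b. prefix (p b) (g b (label (cs ! i b)))"
      "\<And>b. track b cs' = extend b (take (i b) w) @ p b"
      "\<And>b j r. j < length cs \<Longrightarrow> (b, r) \<in> todo (cs ! j) \<Longrightarrow>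
         (b, r) \<in> todo (cs' ! j) \<or> j = i b \<and> r = p b"
      unfolding w by metis
    have "settled cs" using run_Choose[OF run] by (simp add: settled_def)
    then have old: "red (extend False w) = red (extend True w)"
      "\<And>i r. i < length w \<Longrightarrow> r \<in> prefixes_of (w ! i) - todo (cs ! i) \<Longrightarrow> matched w i r"
      using assms(2) by (auto simp: invariant_def)
    have new: "matched w j r" if st: "settled cs'" and j: "j < length w"
      and r: "r \<in> prefixes_of (w ! j) - todo (cs' ! j)" for j r
    proof (cases "r \<in> todo (cs ! j)")
      case True
      obtain b p' where r': "r = (b, p')" by (cases r)
      have ji: "j = i b" "p' = p b" using ip(4)[of j b p'] True r r' j w by auto
      have "prefix (track (\<not> b) cs') (extend (\<not> b) w)"
        unfolding ip(3) using ip(1,2)[of "\<not> b"] w by (intro prefix_extend) auto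
      moreover have "red (track b cs') = red (track (\<not> b) cs')"
        using st unfolding settled_def by (cases b) auto
      ultimately show ?thesis
        by (auto simp: matched_def munn_tree_def r' ji ip(3)[symmetric])
    qed (use old j r in auto)
    show ?thesis
      using old(1) new w run_Choose[OF run] by (auto simp: invariant_def)
  qed
qed

lemma invariant_sweeps:
  assumes "sweeps cs cs'" "invariant w cs"
  shows "invariant w cs'"
  using assms by (induction rule: rtranclp_induct) (auto intro: invariant_sweep)

lemma invariant_encode: "invariant w (map encode w)"
  by (auto simp: invariant_def settled_def track_def encode_def extend_def comp_def)

text \<open>The empty prefix ends in the first cell, hence the assumption that there is one.\<close>

lemma prefix_extendE:
  assumes "prefix q (extend b w)" "w \<noteq> []"
  obtains i p where "i < length w" "prefix p (g b (w ! i))" "q = extend b (take i w) @ p"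
proof -
  have "\<exists>i p. i < length w \<and> prefix p (g b (w ! i)) \<and> q = extend b (take i w) @ p"
    using assms
  proof (induction w arbitrary: q)
    case (Cons x w)
    have "prefix q (g b x @ extend b w)" using Cons.prems by (simp add: extend_def)
    then consider "prefix q (g b x)" | q' where "q = g b x @ q'" "prefix q' (extend b w)"
      by (auto simp: prefix_append)
    then show ?case
    proof cases
      case 1
      then show ?thesis by (intro exI[of _ 0] exI[of _ q]) (simp add: extend_def)
    next
      case 2
      show ?thesis
      proof (cases "w = []")
        case True
        then show ?thesis using 2 by (intro exI[of _ 0] exI[of _ q]) (simp add: extend_def)
      next
        case False
        from Cons.IH[OF 2(2) False] obtain i p where
          "i < length w" "prefix p (g b (w ! i))" "q' = extend b (take i w) @ p" by blast
        then show ?thesis using 2 by (intro exI[of _ "Suc i"] exI[of _ p]) (simp add: extend_def)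
      qed
    qed
  qed simp
  then show ?thesis using that by blast
qed

lemma sound:
  assumes "sweeps (map encode w) cs" "cs \<in> lists finished"
  shows "red (extend False w) = red (extend True w) \<and> munn_tree (extend False w) = munn_tree (extend True w)"
proof -
  have inv: "invariant w cs" using assms(1) invariant_encode invariant_sweeps by blast
  have "track b cs = []" for b
    using assms(2) by (auto simp: track_def finished_def cleared_def)
  then have st: "settled cs" by (simp add: settled_def)
  have len: "length cs = length w" using inv by (auto simp: invariant_def)
  have E: "red (extend False w) = red (extend True w)" using inv st by (simp add: invariant_def)
  have "munn_tree (extend b w) \<subseteq> munn_tree (extend (\<not> b) w)" for b
  proof (cases "w = []")
    case False
    show ?thesis
    proof
      fix r assume "r \<in> munn_tree (extend b w)"
      then obtain q where q: "prefix q (extend b w)" "r = red q" by (auto simp: munn_tree_def)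
      from prefix_extendE[OF q(1) False] obtain i p where
        ip: "i < length w" "prefix p (g b (w ! i))" "q = extend b (take i w) @ p" .
      have "cs ! i \<in> finished" using assms(2) ip(1) len by (auto simp: in_lists_conv_set)
      then have "(b, p) \<in> prefixes_of (w ! i) - todo (cs ! i)"
        using ip(2) by (simp add: prefixes_of_def finished_def)
      then have "matched w i (b, p)" using inv st ip(1) unfolding invariant_def by blast
      then show "r \<in> munn_tree (extend (\<not> b) w)" using q ip by (simp add: matched_def)
    qed
  qed (simp add: extend_def)
  from this[of True] this[of False] E show ?thesis by auto
qed


section \<open>Words of the equaliser are accepted\<close>

lemma short_letter: "x \<in> tilde A \<Longrightarrow> [x] \<in> short"
  using K by (simp add: short_def)

lemma short_appendD: "u @ v \<in> short \<Longrightarrow> v \<in> short"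
  by (auto simp: short_def)

lemma carry_refl: "c \<in> short \<Longrightarrow> ([], c, c, []) \<in> carry"
  by (simp add: carry_def Nil_short)

lemma run_carry_id: "set cs \<subseteq> short \<Longrightarrow> run carry [] cs cs []"
  by (induction cs) (auto intro: run.intros carry_refl)

text \<open>The carried inverse passes over the empty cells and cancels in the first nonempty one.\<close>

lemma run_carry_absorb:
  assumes "set cs \<subseteq> short" "concat cs = y # v"
  shows "\<exists>ds. run carry [inv_letter y] cs ds [] \<and> concat ds = v"
  using assms
proof (induction cs)
  case (Cons c cs)
  show ?case
  proof (cases c)
    case Nil
    with Cons obtain ds where ds: "run carry [inv_letter y] cs ds []" "concat ds = v" by auto
    have "y \<in> \<Union> (set ` set cs)" using Cons.prems(2) Nil by (metis append_Nil concat.simps(2) list.set_intros(1) set_concat)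
    then have "y \<in> tilde A" using Cons.prems(1) by (auto simp: short_def)
    then have "([inv_letter y], [], [], [inv_letter y]) \<in> carry"
      using short_letter[of "inv_letter y"] by (simp add: carry_def Nil_short)
    with ds Nil show ?thesis by (intro exI[of _ "[] # ds"]) (auto intro: run.Cons)
  next
    case (Cons z c')
    then have c: "c = y # c'" "c' @ concat cs = v" using Cons.prems by auto
    have sh: "c \<in> short" "c' \<in> short" "y \<in> tilde A"
      using Cons.prems(1) short_appendD[of "[y]" c'] c(1) by (auto simp: short_def)
    then have "([inv_letter y], c, c', []) \<in> carry"
      using short_letter[of "inv_letter y"] red_cancel_Cons[of "inv_letter y" c']
      by (simp add: carry_def Nil_short c(1))
    with c Cons.prems run_carry_id[of cs] show ?thesis
      by (intro exI[of _ "c' # cs"]) (auto intro: run.Cons)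
  qed
qed simp

text \<open>A cancelling pair lies inside one cell or is separated by empty cells; in the second case its
  first letter is carried to the second.\<close>

lemma run_carry_cancel:
  assumes "set cs \<subseteq> short" "concat cs = u @ x # inv_letter x # v"
  shows "\<exists>ds. run carry [] cs ds [] \<and> concat ds = u @ v"
  using assms
proof (induction cs arbitrary: u)
  case (Cons c cs)
  have c: "c \<in> short" and cs: "set cs \<subseteq> short" using Cons.prems by auto
  have eq: "c @ concat cs = u @ x # inv_letter x # v" using Cons.prems by simp
  then consider u' where "u = c @ u'" "concat cs = u' @ x # inv_letter x # v"
    | c' where "c = u @ x # c'" "c' @ concat cs = inv_letter x # v"
    by (auto simp: append_eq_append_conv2 append_eq_Cons_conv)
  then show ?case
  proof cases
    case 1
    with Cons.IH cs obtain ds where "run carry [] cs ds []" "concat ds = u' @ v" by blast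
    with 1 c show ?thesis by (intro exI[of _ "c # ds"]) (auto intro: run.Cons carry_refl)
  next
    case 2
    have sh: "u \<in> short" "x \<in> tilde A" using c 2 by (auto simp: short_def)
    show ?thesis
    proof (cases c')
      case Nil
      then have "concat cs = inv_letter x # v" using 2 by simp
      from run_carry_absorb[OF cs this] obtain ds where "run carry [x] cs ds []" "concat ds = v" by auto
      moreover have "([], c, u, [x]) \<in> carry"
        using c 2 Nil sh short_letter by (simp add: carry_def Nil_short)
      ultimately show ?thesis by (intro exI[of _ "u # ds"]) (auto intro: run.Cons)
    next
      case (Cons z c'')
      then have c'': "c = u @ x # inv_letter x # c''" "c'' @ concat cs = v" using 2 by auto
      have "([], c, u @ c'', []) \<in> carry"
        using c sh by (simp add: carry_def Nil_short red_cancel c'') (simp add: short_def)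
      with c'' run_carry_id[OF cs] show ?thesis
        by (intro exI[of _ "(u @ c'') # cs"]) (auto intro: run.Cons)
    qed
  qed
qed simp

text \<open>Runs on the two tracks of equal length combine to a run on cells.\<close>

lemma run_lift:
  assumes "set cs \<subseteq> cells" "\<And>b. run carry (a b) (map (\<lambda>c. scratch c b) cs) (ds b) (a' b)"
  shows "\<exists>cs'. run rules (Reduce a) cs cs' (Reduce a') \<and> map label cs' = map label cs \<and>
    map todo cs' = map todo cs \<and> (\<forall>b. track b cs' = concat (ds b))"
  using assms
proof (induction cs arbitrary: a ds)
  case Nil
  have "a b = a' b \<and> ds b = []" for b using Nil(2)[of b] by (auto elim: run.cases)
  then have "a = a'" "\<And>b. ds b = []" by auto
  then show ?case by (auto simp: track_def intro: run.Nil)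
next
  case (Cons c cs)
  have "\<exists>d ds' a1. ds b = d # ds' \<and> (a b, scratch c b, d, a1) \<in> carry \<and>
      run carry a1 (map (\<lambda>c. scratch c b) cs) ds' (a' b)" for b
    using Cons.prems(2)[of b] by (cases rule: run.cases) auto
  then obtain d ds' a1 where d: "\<And>b. ds b = d b # ds' b" "\<And>b. (a b, scratch c b, d b, a1 b) \<in> carry"
    "\<And>b. run carry (a1 b) (map (\<lambda>c. scratch c b) cs) (ds' b) (a' b)"
    by metis
  from Cons.IH[OF _ d(3)] Cons.prems obtain cs' where cs': "run rules (Reduce a1) cs cs' (Reduce a')"
    "map label cs' = map label cs" "map todo cs' = map todo cs" "\<And>b. track b cs' = concat (ds' b)"
    by auto
  obtain x P s where c: "c = Cell x P s" "x \<in> X" "P \<subseteq> prefixes_of x"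
    using Cons.prems(1) by (auto simp: cells_def)
  have "(Reduce a, c, Cell x P d, Reduce a1) \<in> rules"
    using c d(2) by (auto intro: rules.reduce)
  then show ?case
    using cs' c d(1)
    by (intro exI[of _ "Cell x P d # cs'"]) (auto intro: run.Cons simp: track_def)
qed

lemma run_cells: "run rules q cs cs' q' \<Longrightarrow> set cs' \<subseteq> cells"
  by (induction rule: run.induct) (use rules_subset in auto)

text \<open>If a track is not reduced, it has a cancelling pair. If both are reduced, being equal in the
  free group they are equal words, and their common first letter can be deleted.\<close>

lemma reduce_step:
  assumes "set cs \<subseteq> cells" "settled cs" "track b cs \<noteq> []"
  shows "\<exists>cs'. sweep rules starts ends cs cs' \<and> set cs' \<subseteq> cells \<and> settled cs' \<and>
    map label cs' = map label cs \<and> map todo cs' = map todo cs \<and>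
    length (track False cs') + length (track True cs') < length (track False cs) + length (track True cs)"
proof -
  let ?t = "\<lambda>b. map (\<lambda>c. scratch c b) cs"
  have sh: "set (?t b) \<subseteq> short" for b using assms(1) by (auto simp: cells_def)
  have t: "track b cs = concat (?t b)" for b by (simp add: track_def)
  have "\<exists>a ds. a False = a True \<and> (\<forall>b. a b \<in> short) \<and> (\<forall>b. run carry (a b) (?t b) (ds b) []) \<and>
    length (concat (ds False)) + length (concat (ds True)) < length (track False cs) + length (track True cs)"
  proof (cases "\<forall>b. reduced (track b cs)")
    case False
    then obtain b where "\<not> reduced (concat (?t b))" using t by auto
    then obtain u x v where uv: "concat (?t b) = u @ x # inv_letter x # v" by (rule not_reducedE)
    from run_carry_cancel[OF sh this] obtain es where es: "run carry [] (?t b) es []" "concat es = u @ v"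
      by blast
    let ?ds = "\<lambda>b'. if b' = b then es else ?t b'"
    have "run carry [] (?t b') (?ds b') []" for b' using es run_carry_id[OF sh] by simp
    moreover have "length (concat (?ds False)) + length (concat (?ds True)) <
        length (track False cs) + length (track True cs)"
      unfolding t using uv es(2) by (cases b) auto
    ultimately show ?thesis by (intro exI[of _ "\<lambda>_. []"] exI[of _ ?ds]) (auto simp: Nil_short)
  next
    case True
    then have eq: "track False cs = track True cs"
      using assms(2) by (simp add: settled_def red_reduced)
    then obtain y v where y: "\<And>b. concat (?t b) = y # v"
      using assms(3) unfolding t by (metis (full_types) neq_Nil_conv)
    have "y \<in> \<Union> (set ` set (?t b))" for b using y by (metis list.set_intros(1) set_concat)
    then have yA: "y \<in> tilde A" using sh[of True] unfolding short_def by blast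
    obtain ds where ds: "\<And>b. run carry [inv_letter y] (?t b) (ds b) []" "\<And>b. concat (ds b) = v"
      using run_carry_absorb[OF sh y] by metis
    show ?thesis
      using ds y yA short_letter[of "inv_letter y"]
      by (intro exI[of _ "\<lambda>_. [inv_letter y]"] exI[of _ ds]) (auto simp: t)
  qed
  then obtain a ds where ads: "a False = a True" "\<And>b. a b \<in> short"
    "\<And>b. run carry (a b) (?t b) (ds b) []"
    "length (concat (ds False)) + length (concat (ds True)) < length (track False cs) + length (track True cs)"
    by blast
  obtain cs' where cs': "run rules (Reduce a) cs cs' (Reduce (\<lambda>_. []))" "map label cs' = map label cs"
    "map todo cs' = map todo cs" "\<And>b. track b cs' = concat (ds b)"
    using run_lift[OF assms(1) ads(3)] by blast
  have "red (a b @ track b cs) = red (track b cs')" for b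
    using run_Reduce[OF cs'(1)] by auto
  then have "settled cs'"
    using assms(2) red_left_cancel[of "a False" "track False cs" "track True cs"] ads(1)
    unfolding settled_def by metis
  moreover have "sweep rules starts ends cs cs'"
    unfolding sweep_def
  proof (intro bexI)
    show "Reduce a \<in> starts" "Reduce (\<lambda>_. []) \<in> ends"
      using ads(1,2) Nil_short by (auto simp: starts_def ends_def)
  qed (rule cs'(1))
  ultimately show ?thesis using cs' ads(4) run_cells[OF cs'(1)] by auto
qed

lemma clear:
  assumes "set cs \<subseteq> cells" "settled cs"
  shows "\<exists>cs'. sweeps cs cs' \<and> set cs' \<subseteq> cells \<inter> cleared \<and>
    map label cs' = map label cs \<and> map todo cs' = map todo cs"
  using assms
proof (induction "length (track False cs) + length (track True cs)" arbitrary: cs rule: less_induct)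
  case less
  show ?case
  proof (cases "\<exists>b. track b cs \<noteq> []")
    case True
    then obtain b where "track b cs \<noteq> []" ..
    from reduce_step[OF less.prems this] obtain cs1 where cs1: "sweep rules starts ends cs cs1"
      "set cs1 \<subseteq> cells" "settled cs1" "map label cs1 = map label cs" "map todo cs1 = map todo cs"
      "length (track False cs1) + length (track True cs1) < length (track False cs) + length (track True cs)"
      by blast
    from less.hyps[OF cs1(6,2,3)] cs1(1,4,5) show ?thesis
      by (metis converse_rtranclp_into_rtranclp)
  next
    case False
    then have "scratch c b = []" if "c \<in> set cs" for c b
      using that by (auto simp: track_def)
    then have "set cs \<subseteq> cleared" by (auto simp: cleared_def)
    with less.prems show ?thesis by blast
  qed
qed

lemma choose_sweep:
  assumes cs: "set cs \<subseteq> cells \<inter> cleared"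
    and ip: "\<And>b. i b < length cs" "\<And>b. prefix (p b) (g b (label (cs ! i b)))"
  shows "\<exists>cs'. sweep rules starts ends cs cs' \<and> map label cs' = map label cs \<and>
    (\<forall>j < length cs. todo (cs' ! j) \<subseteq> todo (cs ! j)) \<and> (\<forall>b. (b, p b) \<notin> todo (cs' ! i b)) \<and>
    (\<forall>b. track b cs' = extend b (take (i b) (map label cs)) @ p b)"
proof -
  let ?n = "length cs"
  \<comment> \<open>The words that the sweep writes into the successive cells of track \<open>b\<close>.\<close>
  define pieces where "pieces b =
    map (g b) (take (i b) (map label cs)) @ p b # replicate (?n - Suc (i b)) []" for b
  have len: "length (pieces b) = ?n" for b using ip(1)[of b] by (simp add: pieces_def)
  have piece: "pieces b ! m = (if m < i b then g b (label (cs ! m)) else if m = i b then p b else [])"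
    if "m < ?n" for b m
    using that ip(1)[of b] by (auto simp: pieces_def nth_append nth_Cons')
  define cs' where "cs' = map (\<lambda>m. Cell (label (cs ! m))
    (todo (cs ! m) - {(b, pieces b ! m) | b. \<not> i b < m \<and> i b < Suc m}) (\<lambda>b. pieces b ! m)) [0..<?n]"
  have "run rules (Choose (\<lambda>b. i b < 0)) cs cs' (Choose (\<lambda>b. i b < ?n))"
  proof (rule run_nth[where st = "\<lambda>m. Choose (\<lambda>b. i b < m)"])
    show "length cs' = ?n" by (simp add: cs'_def)
    fix m assume m: "m < ?n"
    then have "cs ! m \<in> cells \<inter> cleared" using cs by auto
    then obtain x P where c: "cs ! m = Cell x P (\<lambda>_. [])" "x \<in> X" "P \<subseteq> prefixes_of x"
      by (auto simp: cells_def cleared_def)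
    have "(Choose (\<lambda>b. i b < m), Cell x P (\<lambda>_. []),
        Cell x (P - {(b, pieces b ! m) | b. \<not> i b < m \<and> i b < Suc m}) (\<lambda>b. pieces b ! m),
        Choose (\<lambda>b. i b < Suc m)) \<in> rules"
      using c(2,3)
    proof (rule rules.choose)
      fix b
      have "prefix (p b) (g b x)" if "i b = m" using ip(2)[of b] that c(1) by simp
      then show "if i b < m then i b < Suc m \<and> pieces b ! m = []
         else if i b < Suc m then prefix (pieces b ! m) (g b x) else pieces b ! m = g b x"
        using m c(1) by (auto simp: piece)
    qed
    then show "(Choose (\<lambda>b. i b < m), cs ! m, cs' ! m, Choose (\<lambda>b. i b < Suc m)) \<in> rules"
      using m c(1) by (simp add: cs'_def)
  qed
  then have "sweep rules starts ends cs cs'"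
    unfolding sweep_def using ip(1)
    by (intro bexI[of _ "Choose (\<lambda>_. False)"] bexI[of _ "Choose (\<lambda>_. True)"])
      (auto simp: starts_def ends_def)
  moreover have "map label cs' = map label cs"
    by (auto simp: cs'_def intro: nth_equalityI)
  moreover have "todo (cs' ! j) \<subseteq> todo (cs ! j)" if "j < ?n" for j
    using that by (auto simp: cs'_def)
  moreover have "(b, p b) \<notin> todo (cs' ! i b)" for b
    using ip(1)[of b] by (auto simp: cs'_def piece)
  moreover have "track b cs' = extend b (take (i b) (map label cs)) @ p b" for b
  proof -
    have "map (\<lambda>c. scratch c b) cs' = map (\<lambda>m. pieces b ! m) [0..<length (pieces b)]"
      by (simp add: cs'_def len)
    then have "track b cs' = concat (pieces b)" unfolding track_def map_nth by simp
    then show ?thesis by (simp add: pieces_def extend_def)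
  qed
  ultimately show ?thesis by blast
qed

context
  fixes w :: "'s list"
  assumes w: "w \<in> lists X"
    and ends_eq: "red (extend False w) = red (extend True w)"
    and trees_eq: "munn_tree (extend False w) = munn_tree (extend True w)"
begin

text \<open>Equality of the Munn trees supplies a prefix of the other image with the same reduced form;
  choosing these two prefixes leaves tracks that can be cleared.\<close>

lemma verify_one:
  assumes cs: "set cs \<subseteq> cells \<inter> cleared" "map label cs = w"
    and i: "i < length cs" "prefix p (g b (w ! i))"
  shows "\<exists>cs'. sweeps cs cs' \<and> set cs' \<subseteq> cells \<inter> cleared \<and> map label cs' = w \<and>
    (\<forall>j < length cs. todo (cs' ! j) \<subseteq> todo (cs ! j)) \<and> (b, p) \<notin> todo (cs' ! i)"
proof -
  have len: "length cs = length w" using cs(2) by auto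
  have "red (extend b (take i w) @ p) \<in> munn_tree (extend b w)"
    using prefix_extend[of i w p b] i len by (auto simp: munn_tree_def)
  then have "red (extend b (take i w) @ p) \<in> munn_tree (extend (\<not> b) w)"
    using trees_eq by (cases b) auto
  then obtain q where q: "prefix q (extend (\<not> b) w)" "red (extend b (take i w) @ p) = red q"
    by (auto simp: munn_tree_def)
  from i len have "w \<noteq> []" by auto
  from prefix_extendE[OF q(1) this] obtain j r where
    j: "j < length w" "prefix r (g (\<not> b) (w ! j))" "q = extend (\<not> b) (take j w) @ r" .
  let ?i = "\<lambda>b'. if b' = b then i else j" and ?p = "\<lambda>b'. if b' = b then p else r"
  have "prefix (?p b') (g b' (label (cs ! ?i b')))" for b'
    using i j cs(2) len by (cases "b' = b") (auto simp: nth_map[of _ cs label, symmetric] simp del: nth_map)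
  moreover have "?i b' < length cs" for b' using i j len by simp
  ultimately obtain cs1 where cs1: "sweep rules starts ends cs cs1" "map label cs1 = w"
    "\<And>j. j < length cs \<Longrightarrow> todo (cs1 ! j) \<subseteq> todo (cs ! j)" "\<And>b'. (b', ?p b') \<notin> todo (cs1 ! ?i b')"
    "\<And>b'. track b' cs1 = extend b' (take (?i b') w) @ ?p b'"
    using choose_sweep[OF cs(1), of ?i ?p] unfolding cs(2) by blast
  have "settled cs1"
    using q(2) j(3) cs1(5) by (cases b) (auto simp: settled_def)
  moreover have "set cs1 \<subseteq> cells" using cs1(1) run_cells unfolding sweep_def by blast
  ultimately obtain cs2 where cs2: "sweeps cs1 cs2" "set cs2 \<subseteq> cells \<inter> cleared"
    "map label cs2 = map label cs1" "map todo cs2 = map todo cs1"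
    using clear by blast
  have "todo (cs2 ! j) = todo (cs1 ! j)" if "j < length cs" for j
    using that cs2(3,4) cs1(2) len by (metis length_map nth_map)
  then have "(\<forall>j < length cs. todo (cs2 ! j) \<subseteq> todo (cs ! j)) \<and> (b, p) \<notin> todo (cs2 ! i)"
    using cs1(3) cs1(4)[of b] i(1) by auto
  moreover have "sweeps cs cs2" using cs1(1) cs2(1) by (rule converse_rtranclp_into_rtranclp)
  ultimately show ?thesis using cs2(2,3) cs1(2) by auto
qed

lemma verify_all:
  assumes "set cs \<subseteq> cells \<inter> cleared" "map label cs = w"
  shows "\<exists>cs'. sweeps cs cs' \<and> cs' \<in> lists finished"
  using assms
proof (induction "\<Sum>j<length w. card (todo (cs ! j))" arbitrary: cs rule: less_induct)
  case less
  have len: "length cs = length w" using less.prems(2) by auto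
  show ?case
  proof (cases "\<forall>c \<in> set cs. todo c = {}")
    case True
    then show ?thesis using less.prems(1) by (auto simp: finished_def)
  next
    case False
    then obtain i b p where i: "i < length cs" "(b, p) \<in> todo (cs ! i)"
      by (metis equals0I in_set_conv_nth surj_pair)
    have sub: "todo (cs ! j) \<subseteq> prefixes_of (w ! j)" if "j < length cs" for j
    proof -
      have "cs ! j \<in> cells" using less.prems(1) that by auto
      moreover have "label (cs ! j) = w ! j" using less.prems(2) that by auto
      ultimately show ?thesis by (auto simp: cells_def)
    qed
    have "prefix p (g b (w ! i))" using sub[OF i(1)] i(2) by (auto simp: prefixes_of_def)
    from verify_one[OF less.prems i(1) this] obtain cs1 where cs1: "sweeps cs cs1"
      "set cs1 \<subseteq> cells \<inter> cleared" "map label cs1 = w"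
      "\<And>j. j < length cs \<Longrightarrow> todo (cs1 ! j) \<subseteq> todo (cs ! j)" "(b, p) \<notin> todo (cs1 ! i)"
      by blast
    have fin: "finite (todo (cs ! j))" if "j < length cs" for j
      using sub[OF that] finite_prefixes_of finite_subset by blast
    have "(\<Sum>j<length w. card (todo (cs1 ! j))) < (\<Sum>j<length w. card (todo (cs ! j)))"
    proof (rule sum_strict_mono_ex1)
      show "\<forall>j\<in>{..<length w}. card (todo (cs1 ! j)) \<le> card (todo (cs ! j))"
        using cs1(4) fin len by (auto intro: card_mono)
      have "todo (cs1 ! i) \<subset> todo (cs ! i)" using cs1(4,5) i by blast
      then show "\<exists>j\<in>{..<length w}. card (todo (cs1 ! j)) < card (todo (cs ! j))"
        using fin i(1) len psubset_card_mono by (metis lessThan_iff)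
    qed simp
    from less.hyps[OF this cs1(2,3)] cs1(1) show ?thesis by (meson rtranclp_trans)
  qed
qed

lemma complete: "\<exists>cs\<in>lists finished. sweeps (map encode w) cs"
proof -
  have "set (map encode w) \<subseteq> cells" using w encode_cells by (auto simp: in_lists_conv_set)
  moreover have "track b (map encode w) = extend b w" for b
    by (simp add: track_def encode_def extend_def comp_def)
  then have "settled (map encode w)" by (simp add: settled_def ends_eq)
  ultimately obtain cs where cs: "sweeps (map encode w) cs" "set cs \<subseteq> cells \<inter> cleared"
    "map label cs = map label (map encode w)"
    using clear by blast
  moreover have "map label (map encode w) = w" by (simp add: encode_def comp_def)
  ultimately show ?thesis using verify_all by (metis rtranclp_trans)
qed

end

lemma extend_in_lists: "w \<in> lists X \<Longrightarrow> extend b w \<in> lists (tilde A)"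
  using g[of _ b] by (induction w) (auto simp: extend_def)

text \<open>Equality of the two images in the free inverse monoid is equality of end vertices and Munn
  trees, which is what the sweeps verify.\<close>

lemma context_sensitive_equaliser:
  "context_sensitive_language X {w \<in> lists X. proj A (extend False w) = proj A (extend True w)}"
proof -
  have "proj A (extend False w) = proj A (extend True w) \<longleftrightarrow>
      (\<exists>cs\<in>lists finished. sweeps (map encode w) cs)" if w: "w \<in> lists X" for w
    unfolding munn[OF extend_in_lists[OF w] extend_in_lists[OF w]]
  proof
    assume "munn_tree (extend False w) = munn_tree (extend True w) \<and>
      red (extend False w) = red (extend True w)"
    then show "\<exists>cs\<in>lists finished. sweeps (map encode w) cs"
      by (elim conjE) (rule complete[OF w])
  next
    assume "\<exists>cs\<in>lists finished. sweeps (map encode w) cs"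
    then obtain cs where "sweeps (map encode w) cs" "cs \<in> lists finished" ..
    from sound[OF this] show "munn_tree (extend False w) = munn_tree (extend True w) \<and>
      red (extend False w) = red (extend True w)" by (rule conj_commute[THEN iffD1])
  qed
  then have "{w \<in> lists X. proj A (extend False w) = proj A (extend True w)} =
      {w \<in> lists X. \<exists>cs\<in>lists finished. sweeps (map encode w) cs}"
    by (intro Collect_cong conj_cong HOL.refl)
  moreover have "starts \<subseteq> control" "ends \<subseteq> control"
    by (auto simp: starts_def ends_def control_def)
  then have "context_sensitive_language X
      {w \<in> lists X. \<exists>cs\<in>lists finished. sweeps (map encode w) cs}"
    by (rule context_sensitive_sweep[OF finite_X finite_control finite_cells rules_subset _ _ encode_cells])
  ultimately show ?thesis by (simp only:)
qed

end

section \<open>Fixed points of endomorphisms\<close>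

theorem theorem4p5:
  fixes A :: "'a set"
    and \<phi> :: "'a letter list set \<Rightarrow> 'a letter list set"
  assumes "finite A"
    and "monoid_endomorphism (free_inverse_monoid A) \<phi>"
  shows "context_sensitive_subset A (Fix (free_inverse_monoid A) \<phi>)"
proof -
  let ?M = "free_inverse_monoid A"
  have hom: "\<phi> \<in> hom ?M ?M" and one: "\<phi> (proj A []) = proj A []"
    using assms(2) by (auto simp: monoid_endomorphism_def one_free_inverse_monoid)
  have "\<exists>u. x \<in> tilde A \<longrightarrow> u \<in> lists (tilde A) \<and> proj A u = \<phi> (proj A [x])" for x
  proof (cases "x \<in> tilde A")
    case True
    then have "proj A [x] \<in> carrier ?M" by (auto simp: carrier_free_inverse_monoid)
    then have "\<phi> (proj A [x]) \<in> carrier ?M" using hom by (rule hom_in_carrier[rotated])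
    then show ?thesis by (auto simp: carrier_free_inverse_monoid)
  qed simp
  then obtain h where h: "\<And>x. x \<in> tilde A \<Longrightarrow> h x \<in> lists (tilde A)"
    "\<And>x. x \<in> tilde A \<Longrightarrow> proj A (h x) = \<phi> (proj A [x])"
    by metis
  have \<phi>: "concat (map h u) \<in> lists (tilde A) \<and> proj A (concat (map h u)) = \<phi> (proj A u)"
    if "u \<in> lists (tilde A)" for u
    using that
  proof (induction u)
    case (Cons x u)
    then have x: "[x] \<in> lists (tilde A)" and u: "u \<in> lists (tilde A)" by auto
    have "\<phi> (proj A (x # u)) = \<phi> (proj A [x] \<otimes>\<^bsub>?M\<^esub> proj A u)"
      using mult_free_inverse_monoid[OF x u] by simp
    also have "\<dots> = \<phi> (proj A [x]) \<otimes>\<^bsub>?M\<^esub> \<phi> (proj A u)"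
      using x u by (intro hom_mult[OF hom]) (auto simp: carrier_free_inverse_monoid)
    also have "\<dots> = proj A (h x) \<otimes>\<^bsub>?M\<^esub> proj A (concat (map h u))"
      using Cons h by simp
    also have "\<dots> = proj A (concat (map h (x # u)))"
      using Cons h by (subst mult_free_inverse_monoid) auto
    finally show ?case using Cons h by auto
  qed (simp add: one)
  have fin: "finite (tilde A)" using assms(1) by (simp add: tilde_def)
  \<comment> \<open>\<open>Fix\<close> is the equaliser of the identity and \<open>h\<close>.\<close>
  define g where "g b x = (if b then h x else [x])" for b x
  define K where "K = Max (insert 1 ((\<lambda>x. length (h x)) ` tilde A))"
  have K: "1 \<le> K" "\<And>x. x \<in> tilde A \<Longrightarrow> length (h x) \<le> K"
    unfolding K_def using fin by (auto intro: Max_ge)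
  interpret two_homs "tilde A" A g K
    using fin assms(1) h K by unfold_locales (auto simp: g_def)
  have ext: "extend False u = u" "extend True u = concat (map h u)" for u
    unfolding extend_def by (induction u) (simp_all add: g_def)
  have "Fix ?M \<phi> = proj A ` {u \<in> lists (tilde A). proj A (extend False u) = proj A (extend True u)}"
  proof (intro equalityI subsetI)
    fix y assume "y \<in> Fix ?M \<phi>"
    then obtain u where u: "u \<in> lists (tilde A)" "y = proj A u" "\<phi> y = y"
      unfolding Fix_def carrier_free_inverse_monoid by blast
    then have "proj A (extend False u) = proj A (extend True u)"
      using \<phi>[OF u(1)] unfolding ext by metis
    then show "y \<in> proj A ` {u \<in> lists (tilde A). proj A (extend False u) = proj A (extend True u)}"
      using u by blast
  next
    fix y assume "y \<in> proj A ` {u \<in> lists (tilde A). proj A (extend False u) = proj A (extend True u)}"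
    then obtain u where u: "u \<in> lists (tilde A)" "y = proj A u"
      "proj A (extend False u) = proj A (extend True u)" by blast
    then have "\<phi> y = y" using \<phi>[OF u(1)] unfolding ext by metis
    with u show "y \<in> Fix ?M \<phi>" unfolding Fix_def carrier_free_inverse_monoid by blast
  qed
  then show ?thesis
    unfolding context_sensitive_subset_def using context_sensitive_equaliser by blast
qed

end
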